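(* For every Dyck prefix $P=a_0\,u\,a_1\cdots u\,a_k$, where $k\ge 0$ and $a_0,\dots,a_k$ are Dyck paths, we have $$f(duP)=\sum\left(\prod_{l=0}^{k}\mathrm{v}(a_l,s_l)\right)J(s_0V_1),$$ where the sum is taken over all finite sequences $(s_l)_{0\le l\le k}$ of Dyck paths with $s_l\ge a_l$ for every $l$, and over all finite sequences $(V_i)_{1\le i\le k+1}$ of Dyck prefixes with $V_i\ge u\,s_i\,V_{i+1}$ for $1\le i\le k$, and $V_{k+1}=\varepsilon$.
   Context: A (binary) path of length $|P|=n\ge 0$ is a word $P=p_1\cdots p_n$ in the letters $u$ (upstep $(1,1)$) and $d$ (downstep $(1,-1)$), viewed as a lattice path starting at the origin $(0,0)$; $\varepsilon$ is the empty path; juxtaposition denotes concatenation. $\mathcal{P}_n$ is the set of paths of length $n$, and $\mathcal{P}=\bigcup_{n\ge0}\mathcal{P}_n$. The height of a point is its $y$-coordinate, and $h_i(P)$ is the height of the $i$-th point (after $i$ steps). $\mathcal{P}_n$ is partially ordered by $P\le Q$ iff $h_i(P)\le h_i(Q)$ for all $1\le i\le n$ (so $P\le Q$ presupposes $|P|=|Q|$); this is a finite distributive lattice with maximum $\mathbf{1}_n=u^n$. A valley of $P$ is the last point of a maximal run of consecutive $d$'s: it is either the middle point of an occurrence of $du$, or the final point of $P$ if $P$ ends with $d$. Turning a valley into a peak means replacing the corresponding $du$ by $ud$, or replacing the final $d$ by $u$ if the valley is the final point. $Q$ covers $P$ iff $Q$ is obtained from $P$ by turning exactly one valley into a peak.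 An interval $[x,y]$ in a poset is small if $y$ is the join of some elements covering $x$. A $P-\mathbf{1}_n$ chain $P=P_0<P_1<\cdots<P_k=\mathbf{1}_n$ (of length $k$) in $\mathcal{P}_n$ has small intervals if for every $i\in\{1,\dots,k\}$ the path $P_i$ is obtained by (simultaneously) turning some valleys of $P_{i-1}$ into peaks. For $P\in\mathcal{P}_n$, $f(P)$ is the number of $P-\mathbf{1}_n$ chains with small intervals whose length is minimum among all $P-\mathbf{1}_n$ chains with small intervals (so $f(\mathbf{1}_n)=1$). A Dyck path is a path that starts and ends at the same height and lies weakly above this height; $\mathcal{D}$ is the set of all Dyck paths, including $\varepsilon$. A Dyck prefix is a path which is a prefix of a Dyck path; every Dyck prefix is uniquely of the form $a_0ua_1\cdots ua_k$ with $k\ge0$, $a_l\in\mathcal{D}$. For $a\in\mathcal{D}$, $\mathrm{hv}(a)$ is the height of the highest valley of $a$, with the convention $\mathrm{hv}(\varepsilon)=0$. A multichain of Dyck paths $\sigma_0\le\sigma_1\le\cdots\le\sigma_h$, where $h=\mathrm{hv}(\sigma_0)$, is of type $\mathrm{v}$ iff for every $j\in\{1,\dots,h\}$ the paths $\sigma_j$ and $\sigma_{j-1}$ have the same valleys (as points) at every height $\le h-j$. For $a,b\in\mathcal{D}$ with $a\le b$, $\mathrm{v}(a,b)$ is the number of multichains of type $\mathrm{v}$ with $\sigma_0=a$ and $\sigma_h=b$, $h=\mathrm{hv}(a)$ (in particular $\mathrm{v}(\varepsilon,\varepsilon)=1$). In this definition each Dyck path is regarded as starting at the origin. For $P\in\mathcal{P}$,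 $J(P)=\bigl|[P,u^{|P|}]\bigr|$, the number of paths $Q$ of length $|P|$ with $Q\ge P$. *)

theory Defs
  imports Complex_Main "HOL-Library.FuncSet"
begin

datatype step = U | D

type_synonym path = "step list"

primrec rise :: "step \<Rightarrow> int" where
  "rise U = 1"
| "rise D = -1"

definition height :: "path \<Rightarrow> nat \<Rightarrow> int" where
  "height P i = (\<Sum>x\<leftarrow>take i P. rise x)"

definition path_le :: "path \<Rightarrow> path \<Rightarrow> bool"  (infix "\<preceq>" 50) where
  "P \<preceq> Q \<longleftrightarrow> length P = length Q \<and> (\<forall>i\<in>{1..length P}. height P i \<le> height Q i)"

definition path_less :: "path \<Rightarrow> path \<Rightarrow> bool"  (infix "\<prec>" 50) where
  "P \<prec> Q \<longleftrightarrow> P \<preceq> Q \<and> P \<noteq> Q"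

definition top_path :: "nat \<Rightarrow> path" where
  "top_path n = replicate n U"

text \<open>Points of a path are numbered from 0 (the origin), so the 0-indexed letter \<open>P ! i\<close> joins
  point \<open>i\<close> to point \<open>Suc i\<close>. A final point reached by a downstep counts as a valley.\<close>

definition valleys :: "path \<Rightarrow> nat set" where
  "valleys P = {i. 1 \<le> i \<and> i \<le> length P \<and> P ! (i - 1) = D \<and> (i = length P \<or> P ! i = U)}"

definition valley_points :: "path \<Rightarrow> (nat \<times> int) set" where
  "valley_points P = (\<lambda>i. (i, height P i)) ` valleys P"

text \<open>Simultaneously turn the valleys in \<open>S\<close> into peaks: the letter before each such
  point becomes \<open>U\<close> and the letter after it, if there is one, becomes \<open>D\<close>. Only meaningful for
  \<open>S \<subseteq> valleys P\<close>, where the occurrences of \<open>du\<close> do not overlap.\<close>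

definition turn_valleys :: "nat set \<Rightarrow> path \<Rightarrow> path" where
  "turn_valleys S P =
     map (\<lambda>i. if Suc i \<in> S then U else if i \<in> S then D else P ! i) [0..<length P]"

text \<open>A chain is the list of its elements, so its length as a chain is one less than its length
  as a list.\<close>

definition small_chain :: "path \<Rightarrow> path list \<Rightarrow> bool" where
  "small_chain P c \<longleftrightarrow>
     c \<noteq> [] \<and> hd c = P \<and> last c = top_path (length P) \<and>
     (\<forall>i\<in>{1..<length c}. c ! (i - 1) \<prec> c ! i \<and>
        (\<exists>S \<subseteq> valleys (c ! (i - 1)). c ! i = turn_valleys S (c ! (i - 1))))"

definition num_min_chains :: "path \<Rightarrow> nat" where
  "num_min_chains P =
     card {c. small_chain P c \<and> (\<forall>c'. small_chain P c' \<longrightarrow> length c \<le> length c')}"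

definition dyck :: "path \<Rightarrow> bool" where
  "dyck P \<longleftrightarrow> height P (length P) = 0 \<and> (\<forall>i\<le>length P. height P i \<ge> 0)"

definition dyck_prefix :: "path \<Rightarrow> bool" where
  "dyck_prefix P \<longleftrightarrow> (\<exists>Q. dyck (P @ Q))"

text \<open>Intended for Dyck paths, whose valleys have nonnegative height; a nonempty one
  ends with \<open>D\<close>, so the maximum is taken over a nonempty set.\<close>

definition hv :: "path \<Rightarrow> nat" where
  "hv a = (if a = [] then 0 else nat (Max (height a ` valleys a)))"

definition v_multichain :: "path list \<Rightarrow> bool" where
  "v_multichain \<sigma> \<longleftrightarrow>
     \<sigma> \<noteq> [] \<and> (let h = hv (\<sigma> ! 0) in
       length \<sigma> = h + 1 \<and>
       (\<forall>j\<le>h. dyck (\<sigma> ! j)) \<and>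
       (\<forall>j\<in>{1..h}. \<sigma> ! (j - 1) \<preceq> \<sigma> ! j \<and>
          {p \<in> valley_points (\<sigma> ! j). snd p \<le> int h - int j} =
          {p \<in> valley_points (\<sigma> ! (j - 1)). snd p \<le> int h - int j}))"

definition num_v :: "path \<Rightarrow> path \<Rightarrow> nat" where
  "num_v a b = card {\<sigma>. v_multichain \<sigma> \<and> hd \<sigma> = a \<and> last \<sigma> = b}"

definition num_above :: "path \<Rightarrow> nat" where
  "num_above P = card {Q. P \<preceq> Q \<and> Q \<preceq> top_path (length P)}"

definition u_join :: "nat \<Rightarrow> (nat \<Rightarrow> path) \<Rightarrow> path" where
  "u_join k a = a 0 @ concat (map (\<lambda>l. U # a l) [1..<Suc k])"

text \<open>The index set of the sum: the sequences \<open>s\<^sub>0, \<dots>, s\<^sub>k\<close> and \<open>V\<^sub>1, \<dots>, V\<^sub>k\<^sub>+\<^sub>1\<close>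
  are extensional functions on \<open>{0..k}\<close> and \<open>{1..k+1}\<close>, so distinct functions are distinct
  sequences.\<close>

definition sequence_pairs :: "nat \<Rightarrow> (nat \<Rightarrow> path) \<Rightarrow> ((nat \<Rightarrow> path) \<times> (nat \<Rightarrow> path)) set" where
  "sequence_pairs k a =
     {(s, V). s \<in> (\<Pi>\<^sub>E l\<in>{0..k}. {b. dyck b \<and> a l \<preceq> b}) \<and>
              V \<in> (\<Pi>\<^sub>E i\<in>{1..k+1}. {W. dyck_prefix W}) \<and>
              (\<forall>i\<in>{1..k}. U # s i @ V (i + 1) \<preceq> V i) \<and>
              V (k + 1) = []}"

end

theory Submission
  imports Defs
begin

text \<open>
  Put \<open>p = uP\<close>, so that the chains to be counted start at \<open>dp\<close>. A path is determined by its
  heights, and \<open>B\<close> arises from \<open>A\<close> by turning some valleys exactly when \<open>A \<preceq> B\<close> and the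
  height of \<open>B\<close> at each point exceeds the height of \<open>A\<close> at every neighbouring point by at most 1
  (\<open>turn_valleys_iff\<close>). So after a step the point \<open>i\<close> can be at its maximal height \<open>i\<close> only if the
  point \<open>i - 1\<close> was at its maximal height before the step. Since \<open>dp\<close> starts by going down, every chain from
  \<open>dp\<close> to the top has at least \<open>|dp|\<close> steps, and in a chain with exactly that many steps the
  point \<open>i\<close> reaches its final height at time \<open>i\<close> and no earlier.

  For such a chain let \<open>C\<^sub>t(x)\<close> be one more than the height of its \<open>t\<close>-th element at the point
  \<open>x + 1\<close>; this starts at \<open>C\<^sub>0 = p\<close>. Instead of the shape at a given time, consider for each
  \<open>r\<close> the path \<open>Q\<^sub>r\<close> bounding the squares above \<open>p\<close> that are filled at least \<open>r + 1\<close> steps ahead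
  of the last possible moment. The raise from \<open>z - 2\<close> to \<open>z\<close> happens at time \<open>z - 1\<close> at the latest, so
  in formulas, for \<open>z\<close> of the parity of \<open>x\<close>,
  \<open>z \<le> Q\<^sub>r(x) \<longleftrightarrow> z \<le> C\<^sub>t(x)\<close> with \<open>t + r = z - 2\<close>.
  The rule is symmetric in \<open>C\<close> and \<open>Q\<close>, hence an involution. It turns the bound of \<open>C\<^sub>t\<^sub>+\<^sub>1\<close> by its
  neighbours in \<open>C\<^sub>t\<close> into the condition that each \<open>Q\<^sub>r\<close> is a path, and the initial value \<open>C\<^sub>0 = p\<close> into the
  condition that \<open>Q\<^sub>r\<close> agrees with \<open>p\<close> at all points of height at most \<open>r\<close>. So the shortest chains
  correspond to the weakly decreasing sequences \<open>Q\<^sub>0, Q\<^sub>1, \<dots>\<close> of paths above \<open>p\<close> with this property,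
  the slow descents to \<open>p\<close> (\<open>num_min_chains_eq_card_slow_descents\<close>).

  Slow descents are easy to decompose. A slow descent to \<open>uP\<close> is a slow descent \<open>R\<close> to \<open>P\<close>, lifted by
  \<open>u\<close>, preceded by any path above \<open>u R\<^sub>0\<close>. A slow descent to \<open>aP\<close> with a Dyck path \<open>a\<close> is a pair of slow descents,
  because the end point of \<open>a\<close> has height 0 and never moves. A slow descent to a Dyck path \<open>a\<close>, read backwards
  from the index \<open>hv a\<close>, where it has come to rest at \<open>a\<close>, is a multichain of type v (\<open>num_v_eq\<close>).
  Applied to \<open>u a\<^sub>0 u a\<^sub>1 \<dots> u a\<^sub>k\<close>, this produces the sum: \<open>s\<^sub>l\<close> is the first path of the slow
  descent to \<open>a\<^sub>l\<close>, \<open>V\<^sub>i\<close> is the path put in front at the \<open>i\<close>-th upstep between Dyck factors, and \<open>J\<close> counts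
  the choices at the very first upstep.
\<close>

section \<open>Heights of paths\<close>

lemma height_0 [simp]: "height P 0 = 0"
  by (simp add: height_def)

lemma height_Suc: "i < length P \<Longrightarrow> height P (Suc i) = height P i + rise (P ! i)"
  by (simp add: height_def take_Suc_conv_app_nth)

lemma height_Cons_Suc [simp]: "height (x # P) (Suc i) = rise x + height P i"
  by (simp add: height_def)

lemma height_append:
  "height (A @ B) i =
     (if i \<le> length A then height A i else height A (length A) + height B (i - length A))"
  by (simp add: height_def)

lemma height_append_right: "height (A @ B) (length A + i) = height A (length A) + height B i"
  by (simp add: height_def)

lemma rise_cases: "rise x = 1 \<and> x = U \<or> rise x = -1 \<and> x = D"
  by (cases x) auto

lemma height_step:
  assumes "i < length P"
  shows "height P (Suc i) = height P i + 1 \<and> P ! i = U \<or> height P (Suc i) = height P i - 1 \<and> P ! i = D"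
  using height_Suc[OF assms] rise_cases[of "P ! i"] by auto

lemma abs_height_step: "i < length P \<Longrightarrow> \<bar>height P (Suc i) - height P i\<bar> = 1"
  using height_step[of i P] by auto

lemma abs_height_step_back:
  "0 < i \<Longrightarrow> i \<le> length P \<Longrightarrow> \<bar>height P (i - 1) - height P i\<bar> = 1"
  using abs_height_step[of "i - 1" P] by (simp add: abs_minus_commute)

lemma height_parity: "i \<le> length P \<Longrightarrow> even (height P i - int i)"
proof (induction i)
  case (Suc i)
  then show ?case using height_step[of i P] by auto
qed simp

lemma height_le: "i \<le> length P \<Longrightarrow> height P i \<le> int i"
proof (induction i)
  case (Suc i)
  then show ?case using height_step[of i P] by auto
qed simp

lemma height_top_path: "i \<le> n \<Longrightarrow> height (top_path n) i = int i"
proof (induction i)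
  case (Suc i)
  then show ?case using height_Suc[of i "top_path n"] by (simp add: top_path_def)
qed simp

lemma length_top_path [simp]: "length (top_path n) = n"
  by (simp add: top_path_def)

lemma path_le_iff: "P \<preceq> Q \<longleftrightarrow> length P = length Q \<and> (\<forall>i\<le>length P. height P i \<le> height Q i)"
proof -
  have "(\<forall>i\<in>{1..length P}. height P i \<le> height Q i) \<longleftrightarrow> (\<forall>i\<le>length P. height P i \<le> height Q i)"
  proof safe
    fix i assume *: "\<forall>i\<in>{1..length P}. height P i \<le> height Q i" "i \<le> length P"
    show "height P i \<le> height Q i"
      using * by (cases i) auto
  qed auto
  then show ?thesis by (simp add: path_le_def)
qed

lemma path_le_length: "P \<preceq> Q \<Longrightarrow> length Q = length P"
  by (simp add: path_le_def)

lemma path_le_height: "P \<preceq> Q \<Longrightarrow> i \<le> length P \<Longrightarrow> height P i \<le> height Q i"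
  by (simp add: path_le_iff)

lemma path_le_refl [simp]: "P \<preceq> P"
  by (simp add: path_le_iff)

lemma path_le_trans: "P \<preceq> Q \<Longrightarrow> Q \<preceq> R \<Longrightarrow> P \<preceq> R"
  by (force simp: path_le_iff)

lemma path_eqI:
  assumes "length P = length Q" and "\<And>i. i \<le> length P \<Longrightarrow> height P i = height Q i"
  shows "P = Q"
proof (rule nth_equalityI)
  fix i assume i: "i < length P"
  then have "height P (Suc i) = height Q (Suc i)" "height P i = height Q i"
    using assms(2) by auto
  then show "P ! i = Q ! i"
    using height_step[OF i] height_step[of i Q] i assms(1) by auto
qed (fact assms(1))

lemma path_le_top: "P \<preceq> top_path (length P)"
  by (simp add: path_le_iff height_top_path height_le)

lemma finite_paths: "finite {Q :: path. length Q = n}"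
proof -
  have "(UNIV :: step set) = {U, D}"
    using step.exhaust by auto
  then have "finite (UNIV :: step set)"
    by (metis finite.emptyI finite.insertI)
  then show ?thesis
    using finite_lists_length_eq[of "UNIV :: step set" n] by simp
qed

lemma finite_above: "finite {Q. P \<preceq> Q}"
  by (rule finite_subset[OF _ finite_paths[of "length P"]]) (auto simp: path_le_length)

lemma finite_dyck_above: "finite {b. dyck b \<and> a \<preceq> b}"
  using finite_above by (rule rev_finite_subset) auto

lemma num_above_eq: "num_above P = card {Q. P \<preceq> Q}"
proof -
  have "{Q. P \<preceq> Q \<and> Q \<preceq> top_path (length P)} = {Q. P \<preceq> Q}"
    using path_le_top path_le_length by metis
  then show ?thesis by (simp add: num_above_def)
qed

lemma path_le_U_iff: "U # P \<preceq> Q \<longleftrightarrow> (\<exists>R. Q = U # R \<and> P \<preceq> R)"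
proof
  assume le: "U # P \<preceq> Q"
  then obtain x R where Q: "Q = x # R"
    using path_le_length[OF le] by (cases Q) auto
  have "x = U"
    using path_le_height[OF le, of 1] Q rise_cases[of x] by auto
  moreover have "P \<preceq> R"
    unfolding path_le_iff
  proof (intro conjI allI impI)
    show "length P = length R"
      using path_le_length[OF le] Q by simp
    fix i assume "i \<le> length P"
    then show "height P i \<le> height R i"
      using path_le_height[OF le, of "Suc i"] Q \<open>x = U\<close> by simp
  qed
  ultimately show "\<exists>R. Q = U # R \<and> P \<preceq> R"
    using Q by blast
next
  assume "\<exists>R. Q = U # R \<and> P \<preceq> R"
  then obtain R where R: "Q = U # R" "P \<preceq> R" by blast
  have "height (U # P) i \<le> height (U # R) i" if "i \<le> Suc (length P)" for i
    using that path_le_height[OF R(2)] by (cases i) auto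
  then show "U # P \<preceq> Q"
    using R path_le_length[OF R(2)] by (simp add: path_le_iff)
qed

lemma num_above_U: "num_above (U # P) = num_above P"
proof -
  have "{Q. U # P \<preceq> Q} = (#) U ` {R. P \<preceq> R}"
    by (auto simp: path_le_U_iff)
  then show ?thesis
    by (simp add: num_above_eq card_image)
qed

definition path_of_heights :: "nat \<Rightarrow> (nat \<Rightarrow> int) \<Rightarrow> path" where
  "path_of_heights n H = map (\<lambda>i. if H i < H (Suc i) then U else D) [0..<n]"

lemma length_path_of_heights [simp]: "length (path_of_heights n H) = n"
  by (simp add: path_of_heights_def)

lemma height_path_of_heights:
  assumes "H 0 = 0" and "\<And>i. i < n \<Longrightarrow> \<bar>H (Suc i) - H i\<bar> = 1" and "i \<le> n"
  shows "height (path_of_heights n H) i = H i"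
  using assms(3)
proof (induction i)
  case (Suc i)
  then show ?case
    using assms(2)[of i] by (auto simp: height_Suc path_of_heights_def)
qed (simp add: assms(1))

text \<open>The description of Dyck prefixes without a completing suffix, see \<open>dyck_prefix_iff\<close>.\<close>

definition nonneg_path :: "path \<Rightarrow> bool" where
  "nonneg_path P \<longleftrightarrow> (\<forall>i\<le>length P. 0 \<le> height P i)"

lemma height_replicate_D: "i \<le> n \<Longrightarrow> height (replicate n D) i = - int i"
proof (induction i)
  case (Suc i)
  then show ?case using height_Suc[of i "replicate n D"] by simp
qed simp

text \<open>A path that stays nonnegative is completed to a Dyck path by descending from its end.\<close>

lemma dyck_prefix_iff: "dyck_prefix P \<longleftrightarrow> nonneg_path P"
proof
  assume "dyck_prefix P"
  then obtain Q where Q: "dyck (P @ Q)"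
    by (auto simp: dyck_prefix_def)
  have "0 \<le> height P i" if "i \<le> length P" for i
  proof -
    have "0 \<le> height (P @ Q) i"
      using Q that by (simp add: dyck_def)
    then show ?thesis
      using that by (simp add: height_append)
  qed
  then show "nonneg_path P"
    by (simp add: nonneg_path_def)
next
  assume P: "nonneg_path P"
  define m where "m = nat (height P (length P))"
  have m: "int m = height P (length P)"
    using P by (simp add: m_def nonneg_path_def)
  have "dyck (P @ replicate m D)"
    unfolding dyck_def
  proof (intro conjI allI impI)
    show "height (P @ replicate m D) (length (P @ replicate m D)) = 0"
      using height_append_right[of P "replicate m D" m] m by (simp add: height_replicate_D)
    fix i assume "i \<le> length (P @ replicate m D)"
    then show "0 \<le> height (P @ replicate m D) i"
      using P m by (auto simp: height_append height_replicate_D nonneg_path_def)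
  qed
  then show "dyck_prefix P"
    by (auto simp: dyck_prefix_def)
qed

lemma dyck_iff: "dyck P \<longleftrightarrow> height P (length P) = 0 \<and> nonneg_path P"
  by (auto simp: dyck_def nonneg_path_def)

lemma nonneg_path_mono: "nonneg_path P \<Longrightarrow> P \<preceq> Q \<Longrightarrow> nonneg_path Q"
  by (force simp: nonneg_path_def path_le_iff)

lemma nonneg_path_U: "nonneg_path P \<Longrightarrow> nonneg_path (U # P)"
  unfolding nonneg_path_def
proof (intro allI impI)
  fix i assume "\<forall>i\<le>length P. 0 \<le> height P i" "i \<le> length (U # P)"
  then show "0 \<le> height (U # P) i" by (cases i) auto
qed

lemma nonneg_path_append: "dyck a \<Longrightarrow> nonneg_path P \<Longrightarrow> nonneg_path (a @ P)"
  by (auto simp: nonneg_path_def dyck_def height_append)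

lemma path_le_append:
  assumes "length a = length b" "height a (length a) = height b (length b)"
  shows "a @ P \<preceq> b @ Q \<longleftrightarrow> a \<preceq> b \<and> P \<preceq> Q"
proof
  assume le: "a @ P \<preceq> b @ Q"
  have "height a i \<le> height b i" if "i \<le> length a" for i
    using path_le_height[OF le, of i] that assms(1) by (simp add: height_append)
  moreover have "height P i \<le> height Q i" if "i \<le> length P" for i
    using path_le_height[OF le, of "length a + i"] that assms height_append_right[of a P i]
      height_append_right[of b Q i] by simp
  ultimately show "a \<preceq> b \<and> P \<preceq> Q"
    using assms(1) path_le_length[OF le] by (simp add: path_le_iff)
next
  assume "a \<preceq> b \<and> P \<preceq> Q"
  then show "a @ P \<preceq> b @ Q"
    using assms by (auto simp: path_le_iff height_append)
qed

section \<open>Small intervals in terms of heights\<close>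

lemma valleys_height:
  "i \<in> valleys P \<longleftrightarrow> 1 \<le> i \<and> i \<le> length P \<and> height P (i - 1) = height P i + 1 \<and>
     (i < length P \<longrightarrow> height P (Suc i) = height P i + 1)"
proof (cases "1 \<le> i \<and> i \<le> length P")
  case True
  then have "P ! (i - 1) = D \<longleftrightarrow> height P (i - 1) = height P i + 1"
    using height_step[of "i - 1" P] by auto
  moreover have "P ! i = U \<longleftrightarrow> height P (Suc i) = height P i + 1" if "i < length P"
    using height_step[OF that] by auto
  ultimately show ?thesis
    using True unfolding valleys_def by (cases "i < length P") simp_all
qed (auto simp: valleys_def)

text \<open>Every letter \<open>d\<close> ending at a point of \<open>S\<close> becomes \<open>u\<close> and every letter \<open>u\<close> starting at one becomes
  \<open>d\<close>; the two changes cancel after the point, so only the points of \<open>S\<close> move.\<close>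

lemma height_turn_valleys:
  assumes S: "S \<subseteq> valleys P" and "i \<le> length P"
  shows "height (turn_valleys S P) i = height P i + (if i \<in> S then 2 else 0)"
  using assms(2)
proof (induction i)
  case 0
  have "0 \<notin> S" using S by (auto simp: valleys_def)
  then show ?case by simp
next
  case (Suc i)
  have Suc_S: "P ! i = D" if "Suc i \<in> S"
    using subsetD[OF S that] by (simp add: valleys_def)
  have S_U: "P ! i = U" if "i \<in> S"
    using subsetD[OF S that] Suc.prems by (simp add: valleys_def)
  have "height (turn_valleys S P) (Suc i) = height (turn_valleys S P) i + rise (turn_valleys S P ! i)"
    using Suc.prems by (intro height_Suc) (simp add: turn_valleys_def)
  also have "turn_valleys S P ! i = (if Suc i \<in> S then U else if i \<in> S then D else P ! i)"
    using Suc.prems by (simp add: turn_valleys_def)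
  finally show ?case
    using Suc Suc_S S_U by (auto simp: height_Suc)
qed

text \<open>Small intervals without mention of valleys. The two inequalities form the condition that the
  exchange of time and height below can translate.\<close>

definition small_step :: "path \<Rightarrow> path \<Rightarrow> bool" where
  "small_step P Q \<longleftrightarrow>
     P \<preceq> Q \<and> (\<forall>i<length P. height Q i \<le> height P (Suc i) + 1 \<and> height Q (Suc i) \<le> height P i + 1)"

text \<open>A valley is a point both of whose neighbours are one higher, so turning it respects the bounds.
  Conversely, a point that is raised moves up by at least 2 for reasons of parity, and the bounds
  by its neighbours leave room for this only if it is a valley, and then for exactly 2.\<close>

lemma turn_valleys_iff: "(\<exists>S \<subseteq> valleys P. Q = turn_valleys S P) \<longleftrightarrow> small_step P Q"
proof
  assume "\<exists>S \<subseteq> valleys P. Q = turn_valleys S P"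
  then obtain S where S: "S \<subseteq> valleys P" and Q: "Q = turn_valleys S P" by blast
  have h: "height Q i = height P i + (if i \<in> S then 2 else 0)" if "i \<le> length P" for i
    using height_turn_valleys[OF S that] Q by simp
  have "length Q = length P" using Q by (simp add: turn_valleys_def)
  then have "P \<preceq> Q" using h by (auto simp: path_le_iff)
  moreover have "height Q i \<le> height P (Suc i) + 1 \<and> height Q (Suc i) \<le> height P i + 1"
    if i: "i < length P" for i
  proof -
    have "height Q i \<le> height P (Suc i) + 1"
    proof (cases "i \<in> S")
      case True
      then have "height P (Suc i) = height P i + 1"
        using subsetD[OF S True] i by (simp add: valleys_height)
      then show ?thesis using h[of i] i True by simp
    next
      case False
      then have "height Q i = height P i" using h[of i] i by simp
      then show ?thesis using height_step[OF i] by linarith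
    qed
    moreover have "height Q (Suc i) \<le> height P i + 1"
    proof (cases "Suc i \<in> S")
      case True
      then have "height P i = height P (Suc i) + 1"
        using subsetD[OF S True] by (simp add: valleys_height)
      then show ?thesis using h[of "Suc i"] i True by simp
    next
      case False
      then have "height Q (Suc i) = height P (Suc i)" using h[of "Suc i"] i by simp
      then show ?thesis using height_step[OF i] by linarith
    qed
    ultimately show ?thesis by blast
  qed
  ultimately show "small_step P Q"
    by (simp add: small_step_def)
next
  assume "small_step P Q"
  then have *: "P \<preceq> Q \<and> (\<forall>i<length P. height Q i \<le> height P (Suc i) + 1 \<and> height Q (Suc i) \<le> height P i + 1)"
    by (simp add: small_step_def)
  then have le: "P \<preceq> Q" and len: "length Q = length P"
    by (auto simp: path_le_length)
  define S where "S = {i. i \<le> length P \<and> height P i < height Q i}"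
  have raised: "i \<in> valleys P \<and> height Q i = height P i + 2" if "i \<in> S" for i
  proof -
    have i: "i \<le> length P" "height P i < height Q i"
      using that by (auto simp: S_def)
    then have "0 < i" by (cases i) auto
    then have j: "i - 1 < length P" "Suc (i - 1) = i" using i(1) by auto
    have "even (height Q i - height P i)"
      using height_parity[of i P] height_parity[of i Q] i len by simp
    then have "height P i + 2 \<le> height Q i"
      using i(2) by presburger
    moreover have "height Q i \<le> height P (i - 1) + 1"
      using * j by metis
    moreover have "i < length P \<Longrightarrow> height Q i \<le> height P (Suc i) + 1"
      using * by blast
    ultimately show ?thesis
      using height_step[of "i - 1" P] height_step[of i P] i(1) \<open>0 < i\<close> j unfolding valleys_height
      by (cases "i < length P") auto
  qed
  then have S: "S \<subseteq> valleys P" by blast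
  have "Q = turn_valleys S P"
  proof (rule path_eqI)
    show "length Q = length (turn_valleys S P)"
      using len by (simp add: turn_valleys_def)
    fix i assume "i \<le> length Q"
    then show "height Q i = height (turn_valleys S P) i"
      using height_turn_valleys[OF S, of i] raised[of i] path_le_height[OF le, of i] len
      by (auto simp: S_def)
  qed
  then show "\<exists>S \<subseteq> valleys P. Q = turn_valleys S P"
    using S by blast
qed

text \<open>Decreasing sequences of paths above \<open>P\<close> whose \<open>r\<close>-th term has not left \<open>P\<close> at the points of
  height at most \<open>r\<close>. They reach \<open>P\<close> after finitely many steps, so that infinite
  sequences serve to represent multichains of all lengths at once.\<close>

definition slow_descents :: "path \<Rightarrow> (nat \<Rightarrow> path) set" where
  "slow_descents P = {Q. \<forall>r. P \<preceq> Q r \<and> Q (Suc r) \<preceq> Q r \<and>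
     (\<forall>x\<le>length P. height P x \<le> int r \<longrightarrow> height (Q r) x = height P x)}"

section \<open>Exchanging time and height\<close>

text \<open>The largest \<open>z\<close> of the parity of \<open>x\<close> with \<open>z \<le> F (z - 2 - r) x\<close>. The range of \<open>z\<close> keeps the maximum
  finite; all families of interest take their values in it.\<close>

definition exchange :: "nat \<Rightarrow> (int \<Rightarrow> nat \<Rightarrow> int) \<Rightarrow> int \<Rightarrow> nat \<Rightarrow> int" where
  "exchange n F r x =
     (if x \<le> n then Max {z \<in> {0..int x + 2}. even (z - int x) \<and> z \<le> F (z - 2 - r) x} else 0)"

text \<open>By the assumption \<open>down\<close> the \<open>z\<close> with \<open>z \<le> F (z - 2 - r) x\<close> are closed under subtraction of 2, so
  their maximum decides which \<open>z\<close> of the right parity are among them. The lower bound \<open>p\<close>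
  ensures that there are any.\<close>

lemma exchange_props:
  assumes x: "x \<le> n" and p: "even (p - int x)" "0 \<le> p"
    and bounds: "\<And>t. p \<le> F t x" "\<And>t. F t x \<le> int x + 2"
    and down: "\<And>z r. even (z - int x) \<Longrightarrow> z \<le> F (z - 2 - r) x \<Longrightarrow> z - 2 \<le> F (z - 4 - r) x"
  shows "even (z - int x) \<Longrightarrow> z \<le> exchange n F r x \<longleftrightarrow> z \<le> F (z - 2 - r) x"
    and "even (exchange n F r x - int x)"
    and "p \<le> exchange n F r x"
    and "exchange n F r x \<le> int x + 2"
proof -
  define Z where "Z = {z \<in> {0..int x + 2}. even (z - int x) \<and> z \<le> F (z - 2 - r) x}"
  define m where "m = Max Z"
  have ex: "exchange n F r x = m"
    using x by (simp add: exchange_def Z_def m_def)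
  have fin: "finite Z"
    by (rule finite_subset[of _ "{0..int x + 2}"]) (auto simp: Z_def)
  have p_Z: "p \<in> Z"
    using p bounds(1)[of "p - 2 - r"] order_trans[OF bounds(1) bounds(2)] by (simp add: Z_def)
  have m_Z: "m \<in> Z"
    unfolding m_def using fin p_Z by (intro Max_in) auto
  have m: "0 \<le> m" "m \<le> int x + 2" "even (m - int x)" "m \<le> F (m - 2 - r) x"
    using m_Z by (auto simp: Z_def)
  have le_m: "z \<le> m" if "z \<in> Z" for z
    using that fin by (simp add: m_def)
  have closed: "m - 2 * int i \<le> F (m - 2 * int i - 2 - r) x" for i
  proof (induction i)
    case (Suc i)
    have eq: "m - 2 * int i - 2 = m - 2 * int (Suc i)"
      and eq': "m - 2 * int i - 4 - r = m - 2 * int (Suc i) - 2 - r" by simp_all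
    have "even (m - 2 * int i - int x)" using m(3) by simp
    from down[OF this Suc] show ?case unfolding eq eq' .
  qed (simp add: m(4))
  show "z \<le> exchange n F r x \<longleftrightarrow> z \<le> F (z - 2 - r) x" if even: "even (z - int x)"
  proof
    assume "z \<le> exchange n F r x"
    moreover have "even (m - z)" using even m(3) by simp
    ultimately obtain i where "m - z = 2 * int i"
      using ex by (metis evenE diff_ge_0_iff_ge zero_le_imp_eq_int zero_le_mult_iff
          zero_less_numeral linorder_not_less order_less_imp_le)
    then have "z = m - 2 * int i" by simp
    then show "z \<le> F (z - 2 - r) x"
      using closed[of i] by simp
  next
    assume z: "z \<le> F (z - 2 - r) x"
    show "z \<le> exchange n F r x"
    proof (cases "0 \<le> z")
      case True
      then have "z \<in> Z" using z even bounds(2)[of "z - 2 - r"] by (simp add: Z_def)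
      then show ?thesis using le_m ex by simp
    next
      case False
      then show ?thesis using m(1) ex by simp
    qed
  qed
  show "even (exchange n F r x - int x)" "p \<le> exchange n F r x" "exchange n F r x \<le> int x + 2"
    using m ex le_m[OF p_Z] by auto
qed

lemma int_mono_if_step_mono:
  fixes f :: "int \<Rightarrow> int"
  assumes "\<And>t. f t \<le> f (t + 1)" and "s \<le> t"
  shows "f s \<le> f t"
  using assms(2)
proof (induction t rule: int_ge_induct)
  case (step t)
  then show ?case using assms(1)[of t] by simp
qed simp

text \<open>The heights of a shortest chain from \<open>dp\<close>: \<open>C t x\<close> is one more than the height of the \<open>t\<close>-th element at
  the point \<open>x + 1\<close>, and for \<open>t\<close> beyond either end of the chain the family is constant. The
  assumptions \<open>right\<close> and \<open>left\<close> are the inequalities of \<open>small_step\<close>. The value 0 outside the path makes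
  the family unique.\<close>

locale growth =
  fixes p :: path and C :: "int \<Rightarrow> nat \<Rightarrow> int"
  assumes nonneg: "nonneg_path p"
    and outside: "length p < x \<Longrightarrow> C t x = 0"
    and parity: "x \<le> length p \<Longrightarrow> even (C t x - int x)"
    and initial: "x \<le> length p \<Longrightarrow> t \<le> 0 \<Longrightarrow> C t x = height p x"
    and final: "x \<le> length p \<Longrightarrow> int (length p) < t \<Longrightarrow> C t x = int x + 2"
    and step: "x \<le> length p \<Longrightarrow> C t x \<le> C (t + 1) x"
    and right: "x < length p \<Longrightarrow> C (t + 1) x \<le> C t (Suc x) + 1"
    and left: "x < length p \<Longrightarrow> C (t + 1) (Suc x) \<le> C t x + 1"
begin

lemma mono: "x \<le> length p \<Longrightarrow> s \<le> t \<Longrightarrow> C s x \<le> C t x"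
  by (rule int_mono_if_step_mono[of "\<lambda>t. C t x"]) (rule step)

lemma lower: "x \<le> length p \<Longrightarrow> height p x \<le> C t x"
  using mono[of x "min t 0" t] initial[of x "min t 0"] by simp

lemma upper:
  assumes "x \<le> length p"
  shows "C t x \<le> int x + 2"
proof -
  have "C t x \<le> C (max t (int (length p) + 1)) x"
    using assms by (rule mono) simp
  also have "\<dots> = int x + 2"
    using assms by (rule final) simp
  finally show ?thesis .
qed

text \<open>Two steps raise a point by at most 2, although a point might seem to gain 2 in each: after the
  first gain it is no valley.\<close>

lemma two_steps:
  assumes x: "x \<le> length p"
  shows "C (t + 2) x \<le> C t x + 2"
proof (cases x)
  case 0
  then show ?thesis
    using upper[OF x, of "t + 2"] lower[OF x, of t] by simp
next
  case (Suc y)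
  have "C ((t + 1) + 1) (Suc y) \<le> C (t + 1) y + 1" "C (t + 1) y \<le> C t (Suc y) + 1"
    using left[of y "t + 1"] right[of y t] x Suc by auto
  moreover have "t + 1 + 1 = t + 2" by simp
  ultimately show ?thesis unfolding Suc by simp
qed

text \<open>A raise of the point \<open>x\<close> to its final height \<open>x + 2\<close> needs such a raise of its left neighbour before.\<close>

lemma diagonal_le:
  assumes "x \<le> length p" "t \<le> int x"
  shows "C t x \<le> int x"
  using assms
proof (induction x arbitrary: t)
  case 0
  then show ?case using initial[of 0 t] by simp
next
  case (Suc x)
  have "C (t - 1) x \<le> int x"
    using Suc.prems by (intro Suc.IH) auto
  then show ?case using left[of x "t - 1"] Suc.prems by simp
qed

text \<open>At time \<open>length p + 1\<close> the end of the path is at its final height, and a point can be there only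
  if its left neighbour was at its final height one step earlier.\<close>

lemma diagonal_ge:
  assumes "x \<le> length p" "int x < t"
  shows "C t x = int x + 2"
  using assms
proof (induction x arbitrary: t rule: inc_induct)
  case base
  then show ?case by (intro final) auto
next
  case (step x)
  have "C (t + 1) (Suc x) = int (Suc x) + 2"
    using step.prems by (intro step.IH) auto
  then show ?case using left[of x t] upper[of x t] step by simp
qed

lemma exchange_iff:
    "x \<le> length p \<Longrightarrow> even (z - int x) \<Longrightarrow> z \<le> exchange (length p) C r x \<longleftrightarrow> z \<le> C (z - 2 - r) x"
  and exchange_even: "x \<le> length p \<Longrightarrow> even (exchange (length p) C r x - int x)"
  and exchange_ge: "x \<le> length p \<Longrightarrow> height p x \<le> exchange (length p) C r x"
  and exchange_le: "x \<le> length p \<Longrightarrow> exchange (length p) C r x \<le> int x + 2"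
proof -
  assume x: "x \<le> length p"
  have down: "z - 2 \<le> C (z - 4 - r) x" if "z \<le> C (z - 2 - r) x" for z r
    using two_steps[OF x, of "z - 4 - r"] that
    by (simp add: algebra_simps)
  have "0 \<le> height p x" using nonneg x by (simp add: nonneg_path_def)
  note * = exchange_props[where F = C, OF x height_parity[OF x] this lower[OF x] upper[OF x] down]
  show "even (z - int x) \<Longrightarrow> z \<le> exchange (length p) C r x \<longleftrightarrow> z \<le> C (z - 2 - r) x"
    and "even (exchange (length p) C r x - int x)"
    and "height p x \<le> exchange (length p) C r x"
    and "exchange (length p) C r x \<le> int x + 2"
    by (rule *; assumption)+
qed

end

text \<open>The heights of a slow descent. For \<open>r < 0\<close> the value \<open>x + 2\<close> is what \<open>exchange\<close> produces from the times
  after \<open>x\<close>, at which the point \<open>x\<close> of a growth has its final height.\<close>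

locale descent =
  fixes p :: path and Q :: "int \<Rightarrow> nat \<Rightarrow> int"
  assumes nonneg: "nonneg_path p"
    and outside: "length p < x \<Longrightarrow> Q r x = 0"
    and parity: "x \<le> length p \<Longrightarrow> even (Q r x - int x)"
    and initial: "x \<le> length p \<Longrightarrow> r < 0 \<Longrightarrow> Q r x = int x + 2"
    and origin: "0 \<le> r \<Longrightarrow> Q r 0 = 0"
    and above: "0 \<le> r \<Longrightarrow> x \<le> length p \<Longrightarrow> height p x \<le> Q r x"
    and settled: "0 \<le> r \<Longrightarrow> x \<le> length p \<Longrightarrow> height p x \<le> r \<Longrightarrow> Q r x = height p x"
    and step: "x \<le> length p \<Longrightarrow> Q (r + 1) x \<le> Q r x"
    and right: "x < length p \<Longrightarrow> Q r x \<le> Q r (Suc x) + 1"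
    and left: "x < length p \<Longrightarrow> Q r (Suc x) \<le> Q r x + 1"
begin

lemma antimono:
  assumes "x \<le> length p" "r \<le> s"
  shows "Q s x \<le> Q r x"
  using int_mono_if_step_mono[of "\<lambda>t. - Q t x" r s] step[OF assms(1)] assms(2) by simp

lemma lower: "x \<le> length p \<Longrightarrow> height p x \<le> Q r x"
  using initial[of x r] above[of r x] height_le[of x p] by (cases "r < 0") auto

lemma diagonal_le:
  assumes "0 \<le> r" "x \<le> length p"
  shows "Q r x \<le> int x"
  using assms(2)
proof (induction x)
  case (Suc x)
  then show ?case using left[of x r] by simp
qed (simp add: origin[OF assms(1)])

lemma upper: "x \<le> length p \<Longrightarrow> Q r x \<le> int x + 2"
  using diagonal_le[of r x] initial[of x r] by (cases "r < 0") auto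

lemma exchange_iff:
    "x \<le> length p \<Longrightarrow> even (z - int x) \<Longrightarrow> z \<le> exchange (length p) Q r x \<longleftrightarrow> z \<le> Q (z - 2 - r) x"
  and exchange_even: "x \<le> length p \<Longrightarrow> even (exchange (length p) Q r x - int x)"
  and exchange_ge: "x \<le> length p \<Longrightarrow> height p x \<le> exchange (length p) Q r x"
  and exchange_le: "x \<le> length p \<Longrightarrow> exchange (length p) Q r x \<le> int x + 2"
proof -
  assume x: "x \<le> length p"
  have down: "z - 2 \<le> Q (z - 4 - r) x" if "z \<le> Q (z - 2 - r) x" for z r
    using antimono[OF x, of "z - 4 - r" "z - 2 - r"] that by simp
  have "0 \<le> height p x" using nonneg x by (simp add: nonneg_path_def)
  note * = exchange_props[where F = Q, OF x height_parity[OF x] this lower[OF x] upper[OF x] down]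
  show "even (z - int x) \<Longrightarrow> z \<le> exchange (length p) Q r x \<longleftrightarrow> z \<le> Q (z - 2 - r) x"
    and "even (exchange (length p) Q r x - int x)"
    and "height p x \<le> exchange (length p) Q r x"
    and "exchange (length p) Q r x \<le> int x + 2"
    by (rule *; assumption)+
qed

end

text \<open>Each property of \<open>Q\<close> at a height \<open>z\<close> is one property of \<open>C\<close> at the time \<open>z - 2 - r\<close>: a later time means a
  smaller \<open>r\<close>, so growth becomes descent; a move to a neighbouring point with \<open>z - 1\<close> in place of \<open>z\<close> means
  one time step less, so \<open>right\<close> and \<open>left\<close> become the condition that \<open>Q\<close> changes by at most 1 between
  neighbours; and a raise of \<open>p\<close> at a point of height \<open>y \<le> r\<close> would have to occur at the time \<open>y - r \<le> 0\<close>.\<close>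

lemma (in growth) descent_exchange: "descent p (exchange (length p) C)"
proof
  let ?E = "exchange (length p) C"
  show "nonneg_path p" by (fact nonneg)
  show "?E r x = 0" if "length p < x" for r x
    using that by (simp add: exchange_def)
  show "even (?E r x - int x)" if "x \<le> length p" for r x
    using that by (rule exchange_even)
  show "?E r x = int x + 2" if x: "x \<le> length p" and "r < 0" for r x
  proof -
    have "C (int x + 2 - 2 - r) x = int x + 2"
      using that by (intro diagonal_ge) auto
    then show ?thesis
      using exchange_iff[OF x, of "int x + 2" r] exchange_le[OF x, of r] by simp
  qed
  have settled: "?E r x = height p x" if r: "0 \<le> r" "height p x \<le> r" and x: "x \<le> length p" for r x
  proof -
    have "C (height p x + 2 - 2 - r) x = height p x"
      using r x by (intro initial) auto
    then have "\<not> height p x + 2 \<le> ?E r x"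
      using exchange_iff[OF x, of "height p x + 2" r] height_parity[OF x] by simp
    moreover have "even (?E r x - height p x)"
      using exchange_even[OF x, of r] height_parity[OF x] by simp
    ultimately show ?thesis
      using exchange_ge[OF x, of r] by presburger
  qed
  then show "?E r x = height p x" if "0 \<le> r" "x \<le> length p" "height p x \<le> r" for r x
    using that by blast
  show "?E r 0 = 0" if "0 \<le> r" for r
    using settled[of r 0] that by simp
  show "height p x \<le> ?E r x" if "x \<le> length p" for r x
    using that by (rule exchange_ge)
  show "?E (r + 1) x \<le> ?E r x" if x: "x \<le> length p" for r x
  proof -
    define z where "z = ?E (r + 1) x"
    have even: "even (z - int x)" unfolding z_def by (rule exchange_even[OF x])
    have "z \<le> C (z - 2 - (r + 1)) x"
      using exchange_iff[OF x even, of "r + 1"] by (simp add: z_def)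
    also have "\<dots> \<le> C (z - 2 - r) x" by (rule mono[OF x]) simp
    finally show ?thesis using exchange_iff[OF x even, of r] by (simp add: z_def)
  qed
  show "?E r x \<le> ?E r (Suc x) + 1" if "x < length p" for r x
  proof -
    define z where "z = ?E r x"
    have x: "x \<le> length p" "Suc x \<le> length p" using that by auto
    have even: "even (z - int x)" unfolding z_def by (rule exchange_even[OF x(1)])
    have "z \<le> C (z - 2 - r) x"
      using exchange_iff[OF x(1) even, of r] by (simp add: z_def)
    also have "\<dots> \<le> C ((z - 1) - 2 - r) (Suc x) + 1"
      using right[OF that, of "(z - 1) - 2 - r"] by (simp add: algebra_simps)
    finally have "z - 1 \<le> ?E r (Suc x)"
      using exchange_iff[OF x(2), of "z - 1" r] even by simp
    then show ?thesis by (simp add: z_def)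
  qed
  show "?E r (Suc x) \<le> ?E r x + 1" if "x < length p" for r x
  proof -
    define z where "z = ?E r (Suc x)"
    have x: "x \<le> length p" "Suc x \<le> length p" using that by auto
    have even: "even (z - int (Suc x))" unfolding z_def by (rule exchange_even[OF x(2)])
    have "z \<le> C (z - 2 - r) (Suc x)"
      using exchange_iff[OF x(2) even, of r] by (simp add: z_def)
    also have "\<dots> \<le> C ((z - 1) - 2 - r) x + 1"
      using left[OF that, of "(z - 1) - 2 - r"] by (simp add: algebra_simps)
    finally have "z - 1 \<le> ?E r x"
      using exchange_iff[OF x(1), of "z - 1" r] even by simp
    then show ?thesis by (simp add: z_def)
  qed
qed

lemma (in descent) growth_exchange: "growth p (exchange (length p) Q)"
proof
  let ?E = "exchange (length p) Q"
  show "nonneg_path p" by (fact nonneg)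
  show "?E t x = 0" if "length p < x" for t x
    using that by (simp add: exchange_def)
  show "even (?E t x - int x)" if "x \<le> length p" for t x
    using that by (rule exchange_even)
  show "?E t x = int x + 2" if x: "x \<le> length p" and "int (length p) < t" for t x
  proof -
    have "Q (int x + 2 - 2 - t) x = int x + 2"
      using that by (intro initial) auto
    then show ?thesis
      using exchange_iff[OF x, of "int x + 2" t] exchange_le[OF x, of t] by simp
  qed
  show "?E t x = height p x" if x: "x \<le> length p" and t: "t \<le> 0" for t x
  proof -
    have "0 \<le> height p x" using nonneg x by (simp add: nonneg_path_def)
    then have "Q (height p x + 2 - 2 - t) x = height p x"
      using t x by (intro settled) auto
    then have "\<not> height p x + 2 \<le> ?E t x"
      using exchange_iff[OF x, of "height p x + 2" t] height_parity[OF x] by simp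
    moreover have "even (?E t x - height p x)"
      using exchange_even[OF x, of t] height_parity[OF x] by simp
    ultimately show ?thesis
      using exchange_ge[OF x, of t] by presburger
  qed
  show "?E t x \<le> ?E (t + 1) x" if x: "x \<le> length p" for t x
  proof -
    define z where "z = ?E t x"
    have even: "even (z - int x)" unfolding z_def by (rule exchange_even[OF x])
    have "z \<le> Q (z - 2 - t) x"
      using exchange_iff[OF x even, of t] by (simp add: z_def)
    also have "\<dots> \<le> Q (z - 2 - (t + 1)) x" by (rule antimono[OF x]) simp
    finally show ?thesis using exchange_iff[OF x even, of "t + 1"] by (simp add: z_def)
  qed
  show "?E (t + 1) x \<le> ?E t (Suc x) + 1" if "x < length p" for t x
  proof -
    define z where "z = ?E (t + 1) x"
    have x: "x \<le> length p" "Suc x \<le> length p" using that by auto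
    have even: "even (z - int x)" unfolding z_def by (rule exchange_even[OF x(1)])
    have "z \<le> Q (z - 2 - (t + 1)) x"
      using exchange_iff[OF x(1) even, of "t + 1"] by (simp add: z_def)
    also have "\<dots> \<le> Q ((z - 1) - 2 - t) (Suc x) + 1"
      using right[OF that, of "(z - 1) - 2 - t"] by (simp add: algebra_simps)
    finally have "z - 1 \<le> ?E t (Suc x)"
      using exchange_iff[OF x(2), of "z - 1" t] even by simp
    then show ?thesis by (simp add: z_def)
  qed
  show "?E (t + 1) (Suc x) \<le> ?E t x + 1" if "x < length p" for t x
  proof -
    define z where "z = ?E (t + 1) (Suc x)"
    have x: "x \<le> length p" "Suc x \<le> length p" using that by auto
    have even: "even (z - int (Suc x))" unfolding z_def by (rule exchange_even[OF x(2)])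
    have "z \<le> Q (z - 2 - (t + 1)) (Suc x)"
      using exchange_iff[OF x(2) even, of "t + 1"] by (simp add: z_def)
    also have "\<dots> \<le> Q ((z - 1) - 2 - t) x + 1"
      using left[OF that, of "(z - 1) - 2 - t"] by (simp add: algebra_simps)
    finally have "z - 1 \<le> ?E t x"
      using exchange_iff[OF x(1), of "z - 1" t] even by simp
    then show ?thesis by (simp add: z_def)
  qed
qed

lemma (in growth) exchange_exchange: "exchange (length p) (exchange (length p) C) = C"
proof (intro ext)
  fix t x
  interpret E: descent p "exchange (length p) C" by (rule descent_exchange)
  let ?EE = "exchange (length p) (exchange (length p) C)"
  show "?EE t x = C t x"
  proof (cases "x \<le> length p")
    case x: True
    have *: "z \<le> ?EE t x \<longleftrightarrow> z \<le> C t x" if "even (z - int x)" for z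
      using E.exchange_iff[OF x that, of t] exchange_iff[OF x that, of "z - 2 - t"] by simp
    show ?thesis
      using *[OF E.exchange_even[OF x, of t]] *[OF parity[OF x, of t]] by simp
  qed (simp add: exchange_def outside)
qed

lemma (in descent) exchange_exchange: "exchange (length p) (exchange (length p) Q) = Q"
proof (intro ext)
  fix r x
  interpret E: growth p "exchange (length p) Q" by (rule growth_exchange)
  let ?EE = "exchange (length p) (exchange (length p) Q)"
  show "?EE r x = Q r x"
  proof (cases "x \<le> length p")
    case x: True
    have *: "z \<le> ?EE r x \<longleftrightarrow> z \<le> Q r x" if "even (z - int x)" for z
      using E.exchange_iff[OF x that, of r] exchange_iff[OF x that, of "z - 2 - r"] by simp
    show ?thesis
      using *[OF E.exchange_even[OF x, of r]] *[OF parity[OF x, of r]] by simp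
  qed (simp add: exchange_def outside)
qed

text \<open>The rule \<open>z \<le> Q r x \<longleftrightarrow> z \<le> C t x\<close> for \<open>t + r = z - 2\<close> is symmetric in the two families, so \<open>exchange\<close>
  is its own inverse.\<close>

lemma bij_betw_exchange: "bij_betw (exchange (length p)) {C. growth p C} {Q. descent p Q}"
  by (rule bij_betw_byWitness[of _ "exchange (length p)"])
    (auto simp: growth.exchange_exchange descent.exchange_exchange
      intro: growth.descent_exchange descent.growth_exchange)

text \<open>Encoding of a slow descent as a \<open>descent\<close>; its inverse is \<open>descent_paths\<close>.\<close>

definition descent_of :: "path \<Rightarrow> (nat \<Rightarrow> path) \<Rightarrow> int \<Rightarrow> nat \<Rightarrow> int" where
  "descent_of p Q r x =
     (if length p < x then 0 else if r < 0 then int x + 2 else height (Q (nat r)) x)"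

definition descent_paths :: "path \<Rightarrow> (int \<Rightarrow> nat \<Rightarrow> int) \<Rightarrow> nat \<Rightarrow> path" where
  "descent_paths p F r = path_of_heights (length p) (F (int r))"

lemma length_descent_paths [simp]: "length (descent_paths p F r) = length p"
  by (simp add: descent_paths_def)

lemma (in descent) height_descent_paths:
  "x \<le> length p \<Longrightarrow> height (descent_paths p Q r) x = Q (int r) x"
  unfolding descent_paths_def
proof (rule height_path_of_heights)
  show "Q (int r) 0 = 0" by (rule origin) simp
  fix i assume i: "i < length p"
  have "even (Q (int r) (Suc i) - int (Suc i))" "even (Q (int r) i - int i)"
    by (rule parity; use i in simp)+
  then have "odd (Q (int r) (Suc i) - Q (int r) i)" by simp
  then show "\<bar>Q (int r) (Suc i) - Q (int r) i\<bar> = 1"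
    using left[OF i, of "int r"] right[OF i, of "int r"] by presburger
qed

lemma slow_descentsD:
  assumes "Q \<in> slow_descents P"
  shows "P \<preceq> Q r" and "Q (Suc r) \<preceq> Q r" and "length (Q r) = length P"
    and "x \<le> length P \<Longrightarrow> height P x \<le> int r \<Longrightarrow> height (Q r) x = height P x"
  using assms path_le_length by (auto simp: slow_descents_def)

lemma descent_descent_of:
  assumes p: "nonneg_path p" and Q: "Q \<in> slow_descents p"
  shows "descent p (descent_of p Q)"
proof
  note len = slow_descentsD(3)[OF Q]
  let ?F = "descent_of p Q"
  show "even (?F r x - int x)" if "x \<le> length p" for r x
    using that height_parity[of x "Q (nat r)"] len by (auto simp: descent_of_def)
  show "height p x \<le> ?F r x" if "0 \<le> r" "x \<le> length p" for r x
    using that path_le_height[OF slow_descentsD(1)[OF Q]] by (simp add: descent_of_def)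
  show "?F r x = height p x" if "0 \<le> r" "x \<le> length p" "height p x \<le> r" for r x
    using that slow_descentsD(4)[OF Q, of x "nat r"] by (simp add: descent_of_def)
  show "?F (r + 1) x \<le> ?F r x" if "x \<le> length p" for r x
  proof (cases "0 \<le> r")
    case True
    then have "nat (r + 1) = Suc (nat r)" by simp
    then show ?thesis
      using True that path_le_height[OF slow_descentsD(2)[OF Q], of x "nat r"] len
      by (simp add: descent_of_def)
  next
    case False
    then show ?thesis
      using that height_le[of x "Q (nat (r + 1))"] len by (auto simp: descent_of_def)
  qed
  show "?F r x \<le> ?F r (Suc x) + 1" "?F r (Suc x) \<le> ?F r x + 1" if "x < length p" for r x
    using that height_step[of x "Q (nat r)"] len by (auto simp: descent_of_def)
qed (use p in \<open>simp_all add: descent_of_def\<close>)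

lemma (in descent) descent_paths_slow_descents: "descent_paths p Q \<in> slow_descents p"
  unfolding slow_descents_def path_le_iff mem_Collect_eq
proof (intro allI conjI impI)
  fix r x assume x: "x \<le> length (descent_paths p Q (Suc r))"
  have "Q (int (Suc r)) x \<le> Q (int r) x"
    using step[of x "int r"] x by (simp add: add.commute)
  then show "height (descent_paths p Q (Suc r)) x \<le> height (descent_paths p Q r) x"
    using height_descent_paths[of x r] height_descent_paths[of x "Suc r"] x by simp
qed (use above settled in \<open>simp_all add: height_descent_paths\<close>)

lemma bij_betw_descent_of:
  assumes p: "nonneg_path p"
  shows "bij_betw (descent_of p) (slow_descents p) {F. descent p F}"
proof (rule bij_betw_byWitness[of _ "descent_paths p"])
  show "\<forall>Q\<in>slow_descents p. descent_paths p (descent_of p Q) = Q"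
  proof (intro ballI ext)
    fix Q r assume Q: "Q \<in> slow_descents p"
    interpret descent p "descent_of p Q" by (rule descent_descent_of[OF p Q])
    show "descent_paths p (descent_of p Q) r = Q r"
      by (rule path_eqI) (simp_all add: slow_descentsD(3)[OF Q] height_descent_paths, simp add: descent_of_def)
  qed
  show "\<forall>F\<in>{F. descent p F}. descent_of p (descent_paths p F) = F"
  proof (intro ballI ext)
    fix F r x assume "F \<in> {F. descent p F}"
    then interpret descent p F by simp
    show "descent_of p (descent_paths p F) r x = F r x"
      using outside[of x r] initial[of x r] height_descent_paths[of x "nat r"]
      by (auto simp: descent_of_def)
  qed
qed (use descent_descent_of[OF p] descent.descent_paths_slow_descents in auto)

section \<open>Shortest chains\<close>

lemma small_chainD:
  assumes "small_chain P c"
  shows "c \<noteq> []" "c ! 0 = P" "c ! (length c - 1) = top_path (length P)"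
    and "Suc i < length c \<Longrightarrow> small_step (c ! i) (c ! Suc i)"
    and "i < length c \<Longrightarrow> length (c ! i) = length P"
proof -
  show ne: "c \<noteq> []" and c0: "c ! 0 = P" and "c ! (length c - 1) = top_path (length P)"
    using assms by (auto simp: small_chain_def hd_conv_nth last_conv_nth)
  show step: "small_step (c ! i) (c ! Suc i)" if "Suc i < length c" for i
  proof -
    have "Suc i \<in> {1..<length c}" using that by simp
    then have "\<exists>S \<subseteq> valleys (c ! (Suc i - 1)). c ! Suc i = turn_valleys S (c ! (Suc i - 1))"
      using assms unfolding small_chain_def by blast
    then show ?thesis by (simp add: turn_valleys_iff)
  qed
  show "length (c ! i) = length P" if "i < length c" for i
    using that
  proof (induction i)
    case (Suc i)
    then show ?case
      using step[of i] path_le_length[of "c ! i" "c ! Suc i"] by (simp add: small_step_def)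
  qed (simp add: c0)
qed

lemma small_chainI:
  assumes "c \<noteq> []" "c ! 0 = P" "c ! (length c - 1) = top_path (length P)"
    and "\<And>i. Suc i < length c \<Longrightarrow> small_step (c ! i) (c ! Suc i) \<and> c ! i \<noteq> c ! Suc i"
  shows "small_chain P c"
  unfolding small_chain_def
proof (intro conjI ballI)
  show "hd c = P" "last c = top_path (length P)"
    using assms(1-3) by (auto simp: hd_conv_nth last_conv_nth)
  fix i assume "i \<in> {1..<length c}"
  then have "Suc (i - 1) < length c" "Suc (i - 1) = i" by auto
  then have "small_step (c ! (i - 1)) (c ! i) \<and> c ! (i - 1) \<noteq> c ! i"
    using assms(4)[of "i - 1"] by simp
  then show "c ! (i - 1) \<prec> c ! i"
    and "\<exists>S \<subseteq> valleys (c ! (i - 1)). c ! i = turn_valleys S (c ! (i - 1))"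
    unfolding turn_valleys_iff by (auto simp: path_less_def small_step_def)
qed (fact assms(1))

text \<open>Follow the rightmost point back along the diagonal: at \<open>m\<close> steps before the end of the chain, the
  point \<open>m\<close> places before the end of the path must already be at its maximal height. A chain with
  at most \<open>length p\<close> steps would thus have a first element that is maximal at a point other than the
  origin, but \<open>dp\<close> starts with \<open>d\<close>.\<close>

lemma small_chain_length:
  assumes c: "small_chain (D # p) c"
  shows "length p + 2 \<le> length c"
proof (rule ccontr)
  assume short: "\<not> length p + 2 \<le> length c"
  define m where "m = length c - 1"
  have m: "m < length c" "m \<le> length p"
    using small_chainD(1)[OF c] short by (auto simp: m_def)
  have "height (c ! t) (x + t) \<le> height (D # p) x + int t" if "t < length c" "x + t \<le> Suc (length p)" for t x
    using that
  proof (induction t)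
    case (Suc t)
    have "height (c ! Suc t) (Suc (x + t)) \<le> height (c ! t) (x + t) + 1"
      using small_chainD(4)[OF c, of t] small_chainD(5)[OF c, of t] Suc.prems by (simp add: small_step_def)
    then show ?case using Suc by simp
  qed (simp add: small_chainD(2)[OF c])
  from this[of m "Suc (length p - m)"]
  have "height (top_path (length (D # p))) (Suc (length p)) \<le> height (D # p) (Suc (length p - m)) + int m"
    using m small_chainD(3)[OF c] by (simp add: m_def)
  also have "\<dots> < int (Suc (length p))"
    using m height_le[of "length p - m" p] by simp
  finally show False
    by (simp add: height_top_path)
qed

text \<open>The cut-off of \<open>t\<close> makes the family constant beyond the ends of the chain, negative times being
  mapped to 0 by \<open>nat\<close>.\<close>

definition chain_growth :: "path \<Rightarrow> path list \<Rightarrow> int \<Rightarrow> nat \<Rightarrow> int" where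
  "chain_growth p c t x =
     (if length p < x then 0 else 1 + height (c ! nat (min t (int (length p) + 1))) (Suc x))"

definition growth_path :: "path \<Rightarrow> (int \<Rightarrow> nat \<Rightarrow> int) \<Rightarrow> int \<Rightarrow> path" where
  "growth_path p C t =
     path_of_heights (Suc (length p)) (\<lambda>i. if i = 0 then 0 else C t (i - 1) - 1)"

definition growth_chain :: "path \<Rightarrow> (int \<Rightarrow> nat \<Rightarrow> int) \<Rightarrow> path list" where
  "growth_chain p C = map (\<lambda>t. growth_path p C (int t)) [0..<length p + 2]"

lemma length_growth_path [simp]: "length (growth_path p C t) = Suc (length p)"
  by (simp add: growth_path_def)

lemma length_growth_chain [simp]: "length (growth_chain p C) = length p + 2"
  by (simp add: growth_chain_def)

lemma nth_growth_chain: "t < length p + 2 \<Longrightarrow> growth_chain p C ! t = growth_path p C (int t)"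
  unfolding growth_chain_def using nth_upt[of 0 t "length p + 2"] by (simp del: upt_Suc add_2_eq_Suc')

lemma (in growth) height_growth_path:
  assumes "x \<le> length p"
  shows "height (growth_path p C t) (Suc x) = C t x - 1"
proof -
  let ?H = "\<lambda>i. if i = 0 then 0 else C t (i - 1) - 1"
  have "height (growth_path p C t) (Suc x) = ?H (Suc x)"
    unfolding growth_path_def
  proof (rule height_path_of_heights)
    fix i assume i: "i < Suc (length p)"
    show "\<bar>?H (Suc i) - ?H i\<bar> = 1"
    proof (cases i)
      case 0
      have "even (C t 0)" "0 \<le> C t 0" "C t 0 \<le> 2"
        using parity[of 0 t] lower[of 0 t] upper[of 0 t] by auto
      then have "\<bar>C t 0 - 1\<bar> = 1" by presburger
      then show ?thesis using 0 by simp
    next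
      case (Suc x)
      then have x: "x < length p" using i by simp
      have "even (C t (Suc x) - int (Suc x))" "even (C t x - int x)"
        by (rule parity; use x in simp)+
      then have "odd (C t (Suc x) - C t x)" by simp
      moreover have "C t x \<le> C t (Suc x) + 1"
        using step[of x t] right[OF x, of t] x by simp
      moreover have "C t (Suc x) \<le> C t x + 1"
        using step[of "Suc x" t] left[OF x, of t] x by simp
      ultimately have "\<bar>C t (Suc x) - C t x\<bar> = 1" by presburger
      then show ?thesis using Suc by simp
    qed
  qed (use assms in simp_all)
  then show ?thesis by simp
qed

lemma growth_chain_growth:
  assumes p: "nonneg_path p" and c: "small_chain (D # p) c" and len: "length c = length p + 2"
  shows "growth p (chain_growth p c)"
proof -
  note len_nth = small_chainD(5)[OF c]
  define k where "k t = nat (min t (int (length p) + 1))" for t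
  have k: "k t < length c" for t
    using len by (auto simp: k_def)
  have len_k: "length (c ! k t) = Suc (length p)" for t
    using len_nth[OF k] by simp
  have k_step: "k (t + 1) = k t \<or> k (t + 1) = Suc (k t) \<and> small_step (c ! k t) (c ! k (t + 1))" for t
  proof -
    have "k (t + 1) = k t \<or> k (t + 1) = Suc (k t)" by (auto simp: k_def)
    then show ?thesis using small_chainD(4)[OF c, of "k t"] k[of "t + 1"] by auto
  qed
  have F: "chain_growth p c t x = 1 + height (c ! k t) (Suc x)" if "x \<le> length p" for t x
    using that by (simp add: k_def chain_growth_def)
  show ?thesis
  proof
    show "chain_growth p c t x = 0" if "length p < x" for t x
      using that by (simp add: chain_growth_def)
    show "even (chain_growth p c t x - int x)" if "x \<le> length p" for t x
      using that height_parity[of "Suc x" "c ! k t"] len_k[of t] by (simp add: F)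
    show "chain_growth p c t x = height p x" if "x \<le> length p" "t \<le> 0" for t x
    proof -
      have "k t = 0" using that by (simp add: k_def)
      then show ?thesis using that small_chainD(2)[OF c] by (simp add: F)
    qed
    show "chain_growth p c t x = int x + 2" if "x \<le> length p" "int (length p) < t" for t x
    proof -
      have "k t = length p + 1" using that by (simp add: k_def)
      then show ?thesis
        using that small_chainD(3)[OF c] len by (simp add: F height_top_path)
    qed
    show "chain_growth p c t x \<le> chain_growth p c (t + 1) x" if "x \<le> length p" for t x
      using that k_step[of t] len_k[of t] by (auto simp: F small_step_def path_le_iff)
    show "chain_growth p c (t + 1) x \<le> chain_growth p c t (Suc x) + 1" if "x < length p" for t x
      using that k_step[of t] len_k[of t] height_step[of "Suc x" "c ! k t"]
      by (auto simp: F small_step_def)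
    show "chain_growth p c (t + 1) (Suc x) \<le> chain_growth p c t x + 1" if "x < length p" for t x
      using that k_step[of t] len_k[of t] height_step[of "Suc x" "c ! k t"]
      by (auto simp: F small_step_def)
  qed (rule p)
qed

text \<open>Consecutive elements differ because \<open>C\<close> reaches its final value at the point \<open>t\<close> precisely at
  time \<open>t + 1\<close>.\<close>

lemma (in growth) small_chain_growth_chain: "small_chain (D # p) (growth_chain p C)"
proof (rule small_chainI)
  note h = height_growth_path
  show "growth_chain p C \<noteq> []"
    using length_growth_chain[of p C] by (metis list.size(3) add_is_0 zero_neq_numeral)
  have "growth_path p C 0 = D # p"
  proof (rule path_eqI)
    fix i assume "i \<le> length (growth_path p C 0)"
    then show "height (growth_path p C 0) i = height (D # p) i"
      by (cases i) (simp_all add: h initial)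
  qed simp
  then show "growth_chain p C ! 0 = D # p"
    by (simp add: nth_growth_chain)
  have "growth_path p C (1 + int (length p)) = top_path (Suc (length p))"
  proof (rule path_eqI)
    fix i assume "i \<le> length (growth_path p C (1 + int (length p)))"
    then show "height (growth_path p C (1 + int (length p))) i = height (top_path (Suc (length p))) i"
      by (cases i) (simp_all add: h final height_top_path)
  qed simp
  then show "growth_chain p C ! (length (growth_chain p C) - 1) = top_path (length (D # p))"
    by (simp add: nth_growth_chain)
  fix t assume "Suc t < length (growth_chain p C)"
  then have t: "t \<le> length p" by simp
  let ?P = "growth_path p C (int t)" and ?Q = "growth_path p C (int t + 1)"
  have "height ?P i \<le> height ?Q i" if "i \<le> Suc (length p)" for i
    using that step[of "i - 1" "int t"] by (cases i) (simp_all add: h)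
  moreover have "height ?Q i \<le> height ?P (Suc i) + 1 \<and> height ?Q (Suc i) \<le> height ?P i + 1"
    if "i < Suc (length p)" for i
  proof (cases i)
    case 0
    then show ?thesis
      using lower[of 0 "int t"] upper[of 0 "int t + 1"] by (simp add: h)
  next
    case (Suc x)
    then show ?thesis
      using that left[of x "int t"] right[of x "int t"] by (simp add: h)
  qed
  ultimately have "small_step ?P ?Q"
    by (simp add: small_step_def path_le_iff)
  moreover have "?P \<noteq> ?Q"
  proof
    assume "?P = ?Q"
    then have "C (int t) t = C (int t + 1) t"
      using h[OF t, of "int t"] h[OF t, of "int t + 1"] by simp
    then show False
      using diagonal_le[of t "int t"] diagonal_ge[of t "int t + 1"] t by simp
  qed
  ultimately show "small_step (growth_chain p C ! t) (growth_chain p C ! Suc t)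
      \<and> growth_chain p C ! t \<noteq> growth_chain p C ! Suc t"
    using t by (simp add: nth_growth_chain add.commute)
qed

lemma bij_betw_chain_growth:
  assumes p: "nonneg_path p"
  shows "bij_betw (chain_growth p)
    {c. small_chain (D # p) c \<and> length c = length p + 2} {C. growth p C}"
    (is "bij_betw _ ?chains _")
proof (rule bij_betw_byWitness[of _ "growth_chain p"])
  show "\<forall>c\<in>?chains. growth_chain p (chain_growth p c) = c"
  proof
    fix c assume "c \<in> ?chains"
    then have c: "small_chain (D # p) c" and len: "length c = length p + 2" by auto
    interpret growth p "chain_growth p c" by (rule growth_chain_growth[OF p c len])
    show "growth_chain p (chain_growth p c) = c"
    proof (rule nth_equalityI)
      fix t assume "t < length (growth_chain p (chain_growth p c))"
      then have t: "t < length p + 2" by simp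
      have "growth_path p (chain_growth p c) (int t) = c ! t"
      proof (rule path_eqI)
        show "length (growth_path p (chain_growth p c) (int t)) = length (c ! t)"
          using small_chainD(5)[OF c, of t] t len by simp
        have now: "nat (min (int t) (int (length p) + 1)) = t"
          using t by simp
        fix i assume "i \<le> length (growth_path p (chain_growth p c) (int t))"
        then show "height (growth_path p (chain_growth p c) (int t)) i = height (c ! t) i"
        proof (cases i)
          case (Suc x)
          then have "x \<le> length p" using \<open>i \<le> _\<close> by simp
          then show ?thesis
            using Suc height_growth_path[of x "int t"] unfolding chain_growth_def now by simp
        qed simp
      qed
      then show "growth_chain p (chain_growth p c) ! t = c ! t"
        by (simp add: nth_growth_chain[OF t])
    qed (use len in simp)
  qed
  show "\<forall>C\<in>{C. growth p C}. chain_growth p (growth_chain p C) = C"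
  proof (intro ballI ext)
    fix C t x assume "C \<in> {C. growth p C}"
    then interpret growth p C by simp
    show "chain_growth p (growth_chain p C) t x = C t x"
    proof (cases "x \<le> length p")
      case x: True
      define s where "s = nat (min t (int (length p) + 1))"
      have s: "s < length p + 2" by (auto simp: s_def)
      have "chain_growth p (growth_chain p C) t x = C (int s) x"
        unfolding chain_growth_def s_def[symmetric] nth_growth_chain[OF s]
        using x by (simp add: height_growth_path)
      also have "\<dots> = C t x"
      proof -
        consider "t \<le> 0" | "0 \<le> t" "t \<le> int (length p) + 1" | "int (length p) + 1 < t" by linarith
        then show ?thesis
        proof cases
          case 1 then show ?thesis using initial[OF x] by (simp add: s_def)
        next
          case 2 then show ?thesis by (simp add: s_def)
        next
          case 3 then show ?thesis using final[OF x] by (simp add: s_def)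
        qed
      qed
      finally show ?thesis .
    qed (simp add: outside chain_growth_def)
  qed
  show "chain_growth p ` ?chains \<subseteq> {C. growth p C}"
    using growth_chain_growth[OF p] by auto
  show "growth_chain p ` {C. growth p C} \<subseteq> ?chains"
    using growth.small_chain_growth_chain by auto
qed

text \<open>The constant sequence \<open>p\<close> is a slow descent, so some chain attains the lower bound of
  \<open>small_chain_length\<close>, and the chains of minimum length are those that attain it.\<close>

theorem num_min_chains_eq_card_slow_descents:
  assumes p: "nonneg_path p"
  shows "num_min_chains (D # p) = card (slow_descents p)"
proof -
  let ?chains = "{c. small_chain (D # p) c \<and> length c = length p + 2}"
  have eq: "card ?chains = card (slow_descents p)"
    using bij_betw_same_card[OF bij_betw_chain_growth[OF p]]
      bij_betw_same_card[OF bij_betw_exchange[of p]]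
      bij_betw_same_card[OF bij_betw_descent_of[OF p]] by simp
  have "(\<lambda>_. p) \<in> slow_descents p"
    by (simp add: slow_descents_def)
  then have "{Q. descent p Q} \<noteq> {}"
    using bij_betw_imp_surj_on[OF bij_betw_descent_of[OF p]] by blast
  then have "{C. growth p C} \<noteq> {}"
    using bij_betw_imp_surj_on[OF bij_betw_exchange[of p]] by blast
  then have "?chains \<noteq> {}"
    using bij_betw_imp_surj_on[OF bij_betw_chain_growth[OF p]] by blast
  then have "{c. small_chain (D # p) c \<and> (\<forall>c'. small_chain (D # p) c' \<longrightarrow> length c \<le> length c')} = ?chains"
    using small_chain_length[of p] by (intro Collect_cong) (metis (mono_tags, lifting) all_not_in_conv le_antisym mem_Collect_eq)
  then show ?thesis
    using eq by (simp add: num_min_chains_def)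
qed

section \<open>Valleys at low height\<close>

text \<open>Among all raised points take one of least height in \<open>A\<close>. A lower neighbour would have to be raised
  as well, so both neighbours are higher.\<close>

lemma raised_valley_below_raised_point:
  assumes le: "A \<preceq> B" and x: "x \<le> length A" "height A x < height B x"
  shows "\<exists>v\<in>valleys A. height A v \<le> height A x \<and> height A v < height B v"
proof -
  define R where "R = {y. y \<le> length A \<and> height A y < height B y}"
  have R: "finite (height A ` R)" "height A ` R \<noteq> {}" "x \<in> R"
    using x by (auto simp: R_def)
  then obtain v where v: "v \<in> R" "height A v = Min (height A ` R)"
    using Min_in[OF R(1,2)] by (metis imageE)
  have least: "height A v \<le> height A y" if "y \<in> R" for y
    unfolding v(2) using R(1) that by simp
  have v_le: "v \<le> length A" and raised: "height A v < height B v"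
    using v(1) by (auto simp: R_def)
  have "even (height B v - height A v)"
    using height_parity[of v A] height_parity[of v B] v_le path_le_length[OF le] by simp
  then have raised2: "height A v + 2 \<le> height B v" using raised by presburger
  have "0 < v" using raised by (cases v) auto
  have "height A (v - 1) = height A v + 1"
  proof (rule ccontr)
    assume "height A (v - 1) \<noteq> height A v + 1"
    then have "height A (v - 1) = height A v - 1"
      using abs_height_step_back[OF \<open>0 < v\<close> v_le] by auto
    moreover have "height B v \<le> height B (v - 1) + 1"
      using abs_height_step_back[OF \<open>0 < v\<close>, of B] v_le path_le_length[OF le] by simp
    ultimately show False
      using least[of "v - 1"] raised2 le_trans[OF diff_le_self v_le, of 1] by (simp add: R_def)
  qed
  moreover have "height A (Suc v) = height A v + 1" if v_less: "v < length A"
  proof (rule ccontr)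
    assume "height A (Suc v) \<noteq> height A v + 1"
    then have "height A (Suc v) = height A v - 1"
      using height_step[OF v_less] by auto
    moreover have "height B v \<le> height B (Suc v) + 1"
      using height_step[of v B] v_less path_le_length[OF le] by auto
    ultimately show False
      using least[of "Suc v"] raised2 v_less by (simp add: R_def)
  qed
  ultimately have "v \<in> valleys A"
    using v_le \<open>0 < v\<close> by (simp add: valleys_height)
  then show ?thesis
    using least[OF R(3)] raised by blast
qed

lemma mem_valley_points: "(i, y) \<in> valley_points P \<longleftrightarrow> i \<in> valleys P \<and> y = height P i"
  by (auto simp: valley_points_def)

text \<open>This replaces the condition on valleys in multichains of type v by a condition on heights. If
  low valleys are kept, no point of height at most \<open>c\<close> is raised, since below it a raised
  valley would be lost. If low points are kept, whether such a point is a valley is visible from its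
  neighbours, and a neighbour above it cannot come from one below it, which would be low too.\<close>

lemma same_low_valleys_iff:
  assumes le: "A \<preceq> B"
  shows "{q \<in> valley_points B. snd q \<le> c} = {q \<in> valley_points A. snd q \<le> c} \<longleftrightarrow>
    (\<forall>x\<le>length A. height A x \<le> c \<longrightarrow> height B x = height A x)" (is "?valleys \<longleftrightarrow> ?heights")
proof
  assume same: ?valleys
  show ?heights
  proof (intro allI impI, rule ccontr)
    fix x assume x: "x \<le> length A" "height A x \<le> c" "height B x \<noteq> height A x"
    then have "height A x < height B x" using path_le_height[OF le] by force
    then obtain v where v: "v \<in> valleys A" "height A v \<le> height A x" "height A v < height B v"
      using raised_valley_below_raised_point[OF le x(1)] by blast
    then have "(v, height A v) \<in> {q \<in> valley_points A. snd q \<le> c}"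
      using x(2) by (simp add: mem_valley_points)
    then have "(v, height A v) \<in> valley_points B"
      using same by blast
    then show False using v(3) by (simp add: mem_valley_points)
  qed
next
  assume heights: ?heights
  have len: "length B = length A" using le by (rule path_le_length)
  have same: "i \<in> valleys B \<longleftrightarrow> i \<in> valleys A"
    if i: "i \<le> length A" "height A i \<le> c" for i
  proof (cases "0 < i")
    case True
    have eq: "height B i = height A i" using heights i by blast
    have neighbour: "height B y = height A i + 1 \<longleftrightarrow> height A y = height A i + 1"
      if y: "y \<le> length A" "\<bar>height A y - height A i\<bar> = 1" "\<bar>height B y - height B i\<bar> = 1" for y
    proof
      assume "height B y = height A i + 1"
      show "height A y = height A i + 1"
      proof (rule ccontr)
        assume "height A y \<noteq> height A i + 1"
        then have "height A y = height A i - 1" using y(2) by auto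
        then have "height B y = height A y" using heights y(1) i(2) by simp
        then show False using \<open>height A y = height A i - 1\<close> \<open>height B y = height A i + 1\<close> by simp
      qed
    next
      assume "height A y = height A i + 1"
      then show "height B y = height A i + 1"
        using path_le_height[OF le y(1)] y(3) eq by auto
    qed
    have "height B (i - 1) = height A i + 1 \<longleftrightarrow> height A (i - 1) = height A i + 1"
      using abs_height_step_back[OF True, of A] abs_height_step_back[OF True, of B] i(1) len
      by (intro neighbour) auto
    moreover have "height B (Suc i) = height A i + 1 \<longleftrightarrow> height A (Suc i) = height A i + 1"
      if "i < length A"
      using abs_height_step[of i A] abs_height_step[of i B] that len
      by (intro neighbour) auto
    ultimately show ?thesis
      unfolding valleys_height eq len by blast
  qed (simp add: valleys_height)
  have "(i, y) \<in> {q \<in> valley_points B. snd q \<le> c} \<longleftrightarrow> (i, y) \<in> {q \<in> valley_points A. snd q \<le> c}" for i y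
  proof (cases "i \<le> length A")
    case i: True
    show ?thesis
    proof (cases "height A i \<le> c")
      case True
      then show ?thesis using same[OF i] heights i by (auto simp: mem_valley_points)
    next
      case False
      then have "\<not> height B i \<le> c" using path_le_height[OF le i] by simp
      then show ?thesis using False by (auto simp: mem_valley_points)
    qed
  qed (auto simp: mem_valley_points valleys_height len)
  then show ?valleys unfolding set_eq_iff split_paired_All by blast
qed

section \<open>Slow descents to a Dyck path\<close>

text \<open>Once \<open>r\<close> reaches the height of all valleys, no valley of \<open>P\<close> is raised, hence no point at all.\<close>

lemma slow_descents_constant:
  assumes Q: "Q \<in> slow_descents P" and r: "\<And>v. v \<in> valleys P \<Longrightarrow> height P v \<le> int r"
  shows "Q r = P"
proof (rule path_eqI)
  note le = slow_descentsD(1)[OF Q, of r]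
  show "length (Q r) = length P" by (rule slow_descentsD(3)[OF Q])
  fix x assume x: "x \<le> length (Q r)"
  then have x: "x \<le> length P" using slow_descentsD(3)[OF Q] by simp
  show "height (Q r) x = height P x"
  proof (rule ccontr)
    assume "height (Q r) x \<noteq> height P x"
    then have "height P x < height (Q r) x" using path_le_height[OF le x] by simp
    then obtain v where v: "v \<in> valleys P" "height P v < height (Q r) v"
      using raised_valley_below_raised_point[OF le x] by blast
    have "height (Q r) v = height P v"
      using v(1) r[OF v(1)] by (intro slow_descentsD(4)[OF Q]) (auto simp: valleys_def)
    then show False using v(2) by simp
  qed
qed

lemma finite_slow_descents: "finite (slow_descents P)"
proof -
  let ?n = "length P"
  let ?E = "{..<?n} \<rightarrow>\<^sub>E {W :: path. length W = ?n}"
  have "slow_descents P \<subseteq> (\<lambda>f r. if r < ?n then f r else P) ` ?E"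
  proof
    fix Q assume Q: "Q \<in> slow_descents P"
    have "Q r = P" if "\<not> r < ?n" for r
    proof (rule slow_descents_constant[OF Q])
      fix v assume "v \<in> valleys P"
      then show "height P v \<le> int r"
        using height_le[of v P] that by (auto simp: valleys_def)
    qed
    then have "Q = (\<lambda>r. if r < ?n then restrict Q {..<?n} r else P)"
      by auto
    moreover have "restrict Q {..<?n} \<in> ?E"
      using slow_descentsD(3)[OF Q] by auto
    ultimately show "Q \<in> (\<lambda>f r. if r < ?n then f r else P) ` ?E"
      by blast
  qed
  then show ?thesis
    by (rule finite_subset) (intro finite_imageI finite_PiE finite_paths finite_lessThan)
qed

lemma slow_descents_dyck:
  assumes "dyck a" "Q \<in> slow_descents a"
  shows "dyck (Q r)"
  using assms slow_descentsD(4)[OF assms(2), of "length a" r] slow_descentsD(3)[OF assms(2), of r]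
    nonneg_path_mono[OF _ slow_descentsD(1)[OF assms(2), of r]]
  by (simp add: dyck_iff)

text \<open>Together with \<open>slow_descents_constant\<close>: a slow descent to \<open>a\<close> has come to rest at index \<open>hv a\<close>, which is
  where the multichains of type v start.\<close>

lemma valley_le_hv:
  assumes "v \<in> valleys a"
  shows "height a v \<le> int (hv a)"
proof -
  have "finite (valleys a)"
    by (rule finite_subset[of _ "{..length a}"]) (auto simp: valleys_def)
  then have "height a v \<le> Max (height a ` valleys a)" using assms by simp
  moreover have "a \<noteq> []" using assms by (auto simp: valleys_def)
  ultimately show ?thesis by (simp add: hv_def)
qed

lemma v_multichain_of_slow_descent:
  assumes a: "dyck a" and Q: "Q \<in> slow_descents a"
  shows "v_multichain (map (\<lambda>j. Q (hv a - j)) [0..<Suc (hv a)])"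
proof -
  define h where "h = hv a"
  define \<sigma> where "\<sigma> = map (\<lambda>j. Q (h - j)) [0..<Suc h]"
  have len: "length \<sigma> = h + 1" by (simp add: \<sigma>_def)
  have nth: "\<sigma> ! j = Q (h - j)" if "j \<le> h" for j
    using that nth_upt[of 0 j "Suc h"] by (simp add: \<sigma>_def del: upt_Suc)
  have "\<sigma> ! 0 = a"
    unfolding nth[OF le0] using valley_le_hv by (intro slow_descents_constant[OF Q]) (simp add: h_def)
  then have hv: "hv (\<sigma> ! 0) = h" by (simp add: h_def)
  have steps: "\<sigma> ! (j - 1) \<preceq> \<sigma> ! j \<and>
      {q \<in> valley_points (\<sigma> ! j). snd q \<le> int h - int j} =
      {q \<in> valley_points (\<sigma> ! (j - 1)). snd q \<le> int h - int j}"
    if "j \<in> {1..h}" for j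
  proof -
    \<comment> \<open>The \<open>j\<close>-th step of the multichain leads from the term \<open>r + 1\<close> of the descent to the term \<open>r\<close>.\<close>
    define r where "r = h - j"
    have r: "h - (j - 1) = Suc r" "int h - int j = int r" and j: "j - 1 \<le> h" "j \<le> h"
      using that by (auto simp: r_def)
    note le = slow_descentsD(2)[OF Q, of r]
    have "\<forall>x\<le>length (Q (Suc r)). height (Q (Suc r)) x \<le> int r \<longrightarrow> height (Q r) x = height (Q (Suc r)) x"
    proof (intro allI impI)
      fix x assume "x \<le> length (Q (Suc r))" "height (Q (Suc r)) x \<le> int r"
      then have x: "x \<le> length a" and "height a x \<le> int r"
        using path_le_height[OF slow_descentsD(1)[OF Q, of "Suc r"], of x] slow_descentsD(3)[OF Q, of "Suc r"]
        by auto
      then show "height (Q r) x = height (Q (Suc r)) x"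
        using slow_descentsD(4)[OF Q x, of r] slow_descentsD(4)[OF Q x, of "Suc r"] by simp
    qed
    then show ?thesis
      unfolding nth[OF j(1)] nth[OF j(2)] r r_def[symmetric] same_low_valleys_iff[OF le, of "int r"]
      using le by blast
  qed
  have "\<forall>j\<le>h. dyck (\<sigma> ! j)"
    using nth slow_descents_dyck[OF a Q] by simp
  moreover have "\<sigma> \<noteq> []"
    using len by auto
  ultimately have "v_multichain \<sigma>"
    unfolding v_multichain_def Let_def hv using len steps by blast
  then show ?thesis
    by (simp only: \<sigma>_def h_def)
qed

text \<open>The condition on consecutive paths accumulates: going up the multichain, the points of \<open>a\<close> of height at
  most \<open>h - j\<close> are not moved by the \<open>j\<close>-th step and were not moved by any step before.\<close>

lemma slow_descent_of_v_multichain: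
  assumes \<sigma>: "v_multichain \<sigma>" and a: "\<sigma> ! 0 = a"
  shows "(\<lambda>r. \<sigma> ! (hv a - r)) \<in> slow_descents a"
proof -
  define h where "h = hv a"
  have chain: "\<sigma> ! j \<preceq> \<sigma> ! Suc j" 
    and valleys: "{q \<in> valley_points (\<sigma> ! Suc j). snd q \<le> int h - int (Suc j)} =
          {q \<in> valley_points (\<sigma> ! j). snd q \<le> int h - int (Suc j)}" if "j < h" for j
  proof -
    have "Suc j \<in> {1..h}" using that by simp
    then have "\<sigma> ! (Suc j - 1) \<preceq> \<sigma> ! Suc j \<and>
        {q \<in> valley_points (\<sigma> ! Suc j). snd q \<le> int h - int (Suc j)} =
        {q \<in> valley_points (\<sigma> ! (Suc j - 1)). snd q \<le> int h - int (Suc j)}"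
      using \<sigma> unfolding v_multichain_def Let_def a h_def by blast
    then show "\<sigma> ! j \<preceq> \<sigma> ! Suc j"
      and "{q \<in> valley_points (\<sigma> ! Suc j). snd q \<le> int h - int (Suc j)} =
          {q \<in> valley_points (\<sigma> ! j). snd q \<le> int h - int (Suc j)}" by simp_all
  qed
  have above: "a \<preceq> \<sigma> ! j \<and> (\<forall>x\<le>length a. height a x \<le> int h - int j \<longrightarrow> height (\<sigma> ! j) x = height a x)"
    if "j \<le> h" for j
    using that
  proof (induction j)
    case 0
    then show ?case by (simp add: a)
  next
    case (Suc j)
    then have IH: "a \<preceq> \<sigma> ! j" "\<And>x. x \<le> length a \<Longrightarrow> height a x \<le> int h - int j \<Longrightarrow> height (\<sigma> ! j) x = height a x"
      and j: "j < h" by auto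
    have "height (\<sigma> ! Suc j) x = height a x" if "x \<le> length a" "height a x \<le> int h - int (Suc j)" for x
    proof -
      have "height (\<sigma> ! j) x = height a x" using that by (intro IH(2)) auto
      moreover have "height (\<sigma> ! Suc j) x = height (\<sigma> ! j) x"
        using that calculation valleys[OF j] path_le_length[OF IH(1)]
        unfolding same_low_valleys_iff[OF chain[OF j]] by simp
      ultimately show ?thesis by simp
    qed
    then show ?case
      using path_le_trans[OF IH(1) chain[OF j]] by blast
  qed
  have "\<sigma> ! (h - Suc r) \<preceq> \<sigma> ! (h - r)" for r
  proof (cases "r < h")
    case True
    then have "Suc (h - Suc r) = h - r" by simp
    then show ?thesis using chain[of "h - Suc r"] True by simp
  qed simp
  moreover have "height (\<sigma> ! (h - r)) x = height a x" if "x \<le> length a" "height a x \<le> int r" for r x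
  proof (cases "r \<le> h")
    case True
    then show ?thesis using above[of "h - r"] that by (simp add: of_nat_diff)
  qed (simp add: a)
  ultimately show ?thesis
    using above by (simp add: slow_descents_def h_def)
qed

text \<open>Reversal of the order turns a slow descent into a multichain of type v. The inverse uses that
  \<open>hv a - r = 0\<close> for \<open>r \<ge> hv a\<close>, which gives the constant tail of the descent.\<close>

lemma num_v_eq:
  assumes a: "dyck a"
  shows "num_v a b = card {Q \<in> slow_descents a. Q 0 = b}"
proof -
  define h where "h = hv a"
  define F :: "(nat \<Rightarrow> path) \<Rightarrow> path list" where "F Q = map (\<lambda>j. Q (h - j)) [0..<Suc h]" for Q
  have length_F: "length (F Q) = Suc h" for Q
    by (simp add: F_def)
  have nth_F: "F Q ! j = Q (h - j)" if "j \<le> h" for Q j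
    using that nth_upt[of 0 j "Suc h"] by (simp add: F_def del: upt_Suc)
  have hd_last: "hd (F Q) = Q h" "last (F Q) = Q 0" for Q
  proof -
    have "F Q \<noteq> []" using length_F[of Q] by auto
    then show "hd (F Q) = Q h" "last (F Q) = Q 0"
      by (simp_all add: hd_conv_nth last_conv_nth length_F nth_F)
  qed
  have eventually_a: "Q r = a" if "Q \<in> slow_descents a" "h \<le> r" for Q r
  proof (rule slow_descents_constant[OF that(1)])
    show "height a v \<le> int r" if "v \<in> valleys a" for v
      using valley_le_hv[OF that] \<open>h \<le> r\<close> by (simp add: h_def)
  qed
  have multichain: "\<sigma> ! 0 = a \<and> length \<sigma> = Suc h \<and> last \<sigma> = \<sigma> ! h"
    if "v_multichain \<sigma>" "hd \<sigma> = a" for \<sigma>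
  proof -
    have "\<sigma> \<noteq> []" using that(1) by (simp add: v_multichain_def)
    then have "\<sigma> ! 0 = a" using that(2) by (simp add: hd_conv_nth)
    then have "length \<sigma> = Suc h" using that(1) by (simp add: v_multichain_def Let_def h_def)
    then show ?thesis
      using \<open>\<sigma> ! 0 = a\<close> \<open>\<sigma> \<noteq> []\<close> by (simp add: last_conv_nth)
  qed
  have "bij_betw F {Q \<in> slow_descents a. Q 0 = b} {\<sigma>. v_multichain \<sigma> \<and> hd \<sigma> = a \<and> last \<sigma> = b}"
  proof (rule bij_betw_byWitness[of _ "\<lambda>\<sigma> r. \<sigma> ! (h - r)"])
    show "\<forall>Q\<in>{Q \<in> slow_descents a. Q 0 = b}. (\<lambda>r. F Q ! (h - r)) = Q"
    proof (intro ballI ext)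
      fix Q r assume "Q \<in> {Q \<in> slow_descents a. Q 0 = b}"
      then have Q: "Q \<in> slow_descents a" by simp
      show "F Q ! (h - r) = Q r"
        unfolding nth_F[OF diff_le_self]
        using eventually_a[OF Q, of r] eventually_a[OF Q, of h] by (cases "r \<le> h") simp_all
    qed
    show "\<forall>\<sigma>\<in>{\<sigma>. v_multichain \<sigma> \<and> hd \<sigma> = a \<and> last \<sigma> = b}. F (\<lambda>r. \<sigma> ! (h - r)) = \<sigma>"
    proof
      fix \<sigma> assume "\<sigma> \<in> {\<sigma>. v_multichain \<sigma> \<and> hd \<sigma> = a \<and> last \<sigma> = b}"
      then have \<sigma>: "v_multichain \<sigma>" "hd \<sigma> = a" by auto
      show "F (\<lambda>r. \<sigma> ! (h - r)) = \<sigma>"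
      proof (rule nth_equalityI)
        show "length (F (\<lambda>r. \<sigma> ! (h - r))) = length \<sigma>"
          using multichain[OF \<sigma>] by (simp add: length_F)
        fix j assume "j < length (F (\<lambda>r. \<sigma> ! (h - r)))"
        then show "F (\<lambda>r. \<sigma> ! (h - r)) ! j = \<sigma> ! j"
          by (simp add: length_F nth_F)
      qed
    qed
    show "F ` {Q \<in> slow_descents a. Q 0 = b} \<subseteq> {\<sigma>. v_multichain \<sigma> \<and> hd \<sigma> = a \<and> last \<sigma> = b}"
    proof (rule image_subsetI)
      fix Q assume "Q \<in> {Q \<in> slow_descents a. Q 0 = b}"
      then have Q: "Q \<in> slow_descents a" "Q 0 = b" by auto
      have "v_multichain (F Q)"
        using v_multichain_of_slow_descent[OF a Q(1)] by (simp only: F_def h_def)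
      then show "F Q \<in> {\<sigma>. v_multichain \<sigma> \<and> hd \<sigma> = a \<and> last \<sigma> = b}"
        using hd_last[of Q] eventually_a[OF Q(1), of h] Q(2) by simp
    qed
    show "(\<lambda>\<sigma> r. \<sigma> ! (h - r)) ` {\<sigma>. v_multichain \<sigma> \<and> hd \<sigma> = a \<and> last \<sigma> = b}
        \<subseteq> {Q \<in> slow_descents a. Q 0 = b}"
    proof (rule image_subsetI)
      fix \<sigma> assume "\<sigma> \<in> {\<sigma>. v_multichain \<sigma> \<and> hd \<sigma> = a \<and> last \<sigma> = b}"
      then have \<sigma>: "v_multichain \<sigma>" "hd \<sigma> = a" "last \<sigma> = b" by auto
      have "(\<lambda>r. \<sigma> ! (h - r)) \<in> slow_descents a"
        using slow_descent_of_v_multichain[OF \<sigma>(1)] multichain[OF \<sigma>(1,2)] by (simp add: h_def)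
      then show "(\<lambda>r. \<sigma> ! (h - r)) \<in> {Q \<in> slow_descents a. Q 0 = b}"
        using multichain[OF \<sigma>(1,2)] \<sigma>(3) by simp
    qed
  qed
  from bij_betw_same_card[OF this] show ?thesis
    by (simp add: num_v_def)
qed

lemma sum_slow_descents_dyck:
  fixes g :: "path \<Rightarrow> nat"
  assumes a: "dyck a"
  shows "(\<Sum>Q\<in>slow_descents a. g (Q 0)) = (\<Sum>b | dyck b \<and> a \<preceq> b. num_v a b * g b)"
proof -
  have "(\<Sum>Q\<in>slow_descents a. g (Q 0)) =
      (\<Sum>b | dyck b \<and> a \<preceq> b. \<Sum>Q | Q \<in> slow_descents a \<and> Q 0 = b. g (Q 0))"
    using slow_descents_dyck[OF a] slow_descentsD(1)
    by (intro sum.group[symmetric] finite_slow_descents finite_dyck_above) auto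
  also have "\<dots> = (\<Sum>b | dyck b \<and> a \<preceq> b. num_v a b * g b)"
    by (simp add: num_v_eq[OF a])
  finally show ?thesis .
qed

section \<open>Decomposing slow descents\<close>

text \<open>All points of \<open>uP\<close> other than the origin have height at least 1, so the first term of a slow descent is
  constrained only by the second. From the second term on, removing the initial \<open>u\<close> lowers
  heights and index by 1 simultaneously, which preserves the defining condition.\<close>

lemma bij_betw_slow_descents_U:
  assumes P: "nonneg_path P"
  shows "bij_betw (\<lambda>(R, V) r. case r of 0 \<Rightarrow> V | Suc r \<Rightarrow> U # R r)
    (SIGMA R:slow_descents P. {V. U # R 0 \<preceq> V}) (slow_descents (U # P))"
    (is "bij_betw ?F ?S _")
proof (rule bij_betw_byWitness[of _ "\<lambda>Q. (\<lambda>r. tl (Q (Suc r)), Q 0)"])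
  have U_tl: "U # tl (Q r) = Q r" if "Q \<in> slow_descents (U # P)" for Q r
    using slow_descentsD(1)[OF that, of r] by (auto simp: path_le_U_iff)
  show "\<forall>Q\<in>slow_descents (U # P). ?F (\<lambda>r. tl (Q (Suc r)), Q 0) = Q"
    using U_tl by (auto split: nat.split)
  show "?F ` ?S \<subseteq> slow_descents (U # P)"
  proof clarify
    fix R V assume R: "R \<in> slow_descents P" and V: "U # R 0 \<preceq> V"
    let ?Q = "\<lambda>r. case r of 0 \<Rightarrow> V | Suc r \<Rightarrow> U # R r"
    have above: "U # P \<preceq> U # R r" for r
      by (simp add: path_le_U_iff slow_descentsD(1)[OF R])
    have "U # P \<preceq> ?Q r" for r
      using above path_le_trans[OF above[of 0] V] by (simp split: nat.split)
    moreover have "?Q (Suc r) \<preceq> ?Q r" for r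
      using V slow_descentsD(2)[OF R] by (cases r) (simp_all add: path_le_U_iff)
    moreover have "height (?Q r) x = height (U # P) x"
      if "x \<le> length (U # P)" "height (U # P) x \<le> int r" for r x
    proof (cases x)
      case (Suc y)
      then have y: "y \<le> length P" "height P y \<le> int r - 1" "0 \<le> height P y"
        using that P by (auto simp: nonneg_path_def)
      then obtain r' where "r = Suc r'" by (cases r) auto
      then show ?thesis using slow_descentsD(4)[OF R y(1), of r'] y Suc by simp
    qed simp
    ultimately show "?Q \<in> slow_descents (U # P)"
      unfolding slow_descents_def by blast
  qed
  show "(\<lambda>Q. (\<lambda>r. tl (Q (Suc r)), Q 0)) ` slow_descents (U # P) \<subseteq> ?S"
  proof clarify
    fix Q assume Q: "Q \<in> slow_descents (U # P)"
    let ?R = "\<lambda>r. tl (Q (Suc r))"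
    have UR: "Q (Suc r) = U # ?R r" for r using U_tl[OF Q, of "Suc r"] by simp
    have "P \<preceq> ?R r" for r
      using slow_descentsD(1)[OF Q, of "Suc r"] by (subst (asm) UR) (simp add: path_le_U_iff)
    moreover have "?R (Suc r) \<preceq> ?R r" for r
      using slow_descentsD(2)[OF Q, of "Suc r"]
      by (subst (asm) (1 2) UR) (simp add: path_le_U_iff)
    moreover have "height (?R r) x = height P x" if "x \<le> length P" "height P x \<le> int r" for r x
    proof -
      have "height (U # ?R r) (Suc x) = height (U # P) (Suc x)"
        unfolding UR[symmetric] using that by (intro slow_descentsD(4)[OF Q]) auto
      then show ?thesis by simp
    qed
    ultimately have "?R \<in> slow_descents P"
      unfolding slow_descents_def by blast
    moreover have "U # ?R 0 \<preceq> Q 0"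
      using slow_descentsD(2)[OF Q, of 0] by (subst (asm) UR) simp
    ultimately show "?R \<in> slow_descents P \<and> Q 0 \<in> {V. U # ?R 0 \<preceq> V}"
      by simp
  qed
qed auto

lemma sum_slow_descents_U:
  fixes g :: "path \<Rightarrow> nat"
  assumes "nonneg_path P"
  shows "(\<Sum>Q\<in>slow_descents (U # P). g (Q 0)) = (\<Sum>R\<in>slow_descents P. \<Sum>V | U # R 0 \<preceq> V. g V)"
proof -
  have "(\<Sum>Q\<in>slow_descents (U # P). g (Q 0)) =
      (\<Sum>(R, V)\<in>(SIGMA R:slow_descents P. {V. U # R 0 \<preceq> V}). g V)"
    by (subst sum.reindex_bij_betw[OF bij_betw_slow_descents_U[OF assms], symmetric])
      (simp add: case_prod_unfold)
  also have "\<dots> = (\<Sum>R\<in>slow_descents P. \<Sum>V | U # R 0 \<preceq> V. g V)"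
    by (rule sum.Sigma[symmetric]) (auto simp: finite_slow_descents finite_above)
  finally show ?thesis .
qed

text \<open>The end of \<open>a\<close> has height 0, so no term of a slow descent moves it. It separates each term into a
  part above \<open>a\<close> and a part above \<open>P\<close>.\<close>

lemma bij_betw_slow_descents_append:
  assumes a: "dyck a"
  shows "bij_betw (\<lambda>(A, B) r. A r @ B r) (slow_descents a \<times> slow_descents P) (slow_descents (a @ P))"
    (is "bij_betw ?F ?S _")
proof (rule bij_betw_byWitness[of _ "\<lambda>Q. (\<lambda>r. take (length a) (Q r), \<lambda>r. drop (length a) (Q r))"])
  let ?n = "length a"
  have a_end: "height a ?n = 0" using a by (simp add: dyck_def)
  show "\<forall>AB\<in>?S. (\<lambda>r. take ?n (?F AB r), \<lambda>r. drop ?n (?F AB r)) = AB"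
    by (auto simp: slow_descentsD(3))
  show "?F ` ?S \<subseteq> slow_descents (a @ P)"
  proof clarify
    fix A B assume A: "A \<in> slow_descents a" and B: "B \<in> slow_descents P"
    have A_len: "length (A r) = ?n" and A_end: "height (A r) ?n = 0" for r
      using slow_descentsD(3)[OF A] slow_descentsD(4)[OF A, of ?n r] a_end by auto
    have "a @ P \<preceq> A r @ B r" for r
      using slow_descentsD(1)[OF A] slow_descentsD(1)[OF B] A_len A_end a_end
      by (simp add: path_le_append)
    moreover have "A (Suc r) @ B (Suc r) \<preceq> A r @ B r" for r
      using slow_descentsD(2)[OF A] slow_descentsD(2)[OF B] A_len A_end
      by (simp add: path_le_append)
    moreover have "height (A r @ B r) x = height (a @ P) x"
      if "x \<le> length (a @ P)" "height (a @ P) x \<le> int r" for r x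
      using that slow_descentsD(4)[OF A, of x r] slow_descentsD(4)[OF B, of "x - ?n" r] A_len A_end a_end
      by (auto simp: height_append split: if_splits)
    ultimately show "(\<lambda>r. A r @ B r) \<in> slow_descents (a @ P)"
      unfolding slow_descents_def by blast
  qed
  show "(\<lambda>Q. (\<lambda>r. take ?n (Q r), \<lambda>r. drop ?n (Q r))) ` slow_descents (a @ P) \<subseteq> ?S"
  proof clarify
    fix Q assume Q: "Q \<in> slow_descents (a @ P)"
    define A where "A r = take ?n (Q r)" for r
    define B where "B r = drop ?n (Q r)" for r
    have AB: "Q r = A r @ B r" for r by (simp add: A_def B_def)
    have A_len: "length (A r) = ?n" and B_len: "length (B r) = length P" for r
      using slow_descentsD(3)[OF Q, of r] by (auto simp: A_def B_def)
    have fixed: "height (A r @ B r) x = height (a @ P) x"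
      if "x \<le> length (a @ P)" "height (a @ P) x \<le> int r" for r x
      using slow_descentsD(4)[OF Q that] AB by simp
    have A_end: "height (A r) ?n = 0" for r
      using fixed[of ?n r] A_len a_end by (simp add: height_append)
    have "a @ P \<preceq> A r @ B r" "A (Suc r) @ B (Suc r) \<preceq> A r @ B r" for r
      using slow_descentsD(1,2)[OF Q, of r] AB by simp_all
    then have le: "a \<preceq> A r" "P \<preceq> B r" "A (Suc r) \<preceq> A r" "B (Suc r) \<preceq> B r" for r
      using A_len A_end a_end path_le_append by metis+
    have "height (A r) x = height a x" if "x \<le> ?n" "height a x \<le> int r" for r x
      using fixed[of x r] that A_len by (simp add: height_append)
    moreover have "height (B r) x = height P x" if "x \<le> length P" "height P x \<le> int r" for r x
      using fixed[of "?n + x" r] that A_len[of r] A_end[of r] a_end height_append_right[of a P x]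
        height_append_right[of "A r" "B r" x] by simp
    ultimately have "A \<in> slow_descents a \<and> B \<in> slow_descents P"
      using le unfolding slow_descents_def by blast
    then show "(\<lambda>r. take ?n (Q r)) \<in> slow_descents a \<and> (\<lambda>r. drop ?n (Q r)) \<in> slow_descents P"
      by (simp add: A_def[abs_def] B_def[abs_def])
  qed
qed auto

lemma sum_slow_descents_append:
  fixes g :: "path \<Rightarrow> nat"
  assumes "dyck a"
  shows "(\<Sum>Q\<in>slow_descents (a @ P). g (Q 0)) =
    (\<Sum>A\<in>slow_descents a. \<Sum>B\<in>slow_descents P. g (A 0 @ B 0))"
  by (subst sum.reindex_bij_betw[OF bij_betw_slow_descents_append[OF assms], symmetric])
    (simp add: case_prod_unfold sum.cartesian_product)

section \<open>Summing over the factors\<close>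

lemma u_join_0: "u_join 0 a = a 0"
  by (simp add: u_join_def)

lemma u_join_Suc: "u_join (Suc k) a = a 0 @ U # u_join k (\<lambda>l. a (Suc l))"
proof -
  have "[1..<Suc (Suc k)] = 1 # map Suc [1..<Suc k]"
    by (simp add: map_Suc_upt upt_conv_Cons del: upt_Suc)
  then show ?thesis
    by (simp add: u_join_def comp_def del: upt_Suc)
qed

lemma nonneg_u_join: "\<forall>l\<le>k. dyck (a l) \<Longrightarrow> nonneg_path (u_join k a)"
proof (induction k arbitrary: a)
  case 0
  then show ?case by (simp add: u_join_0 dyck_iff)
next
  case (Suc k)
  then have "nonneg_path (u_join k (\<lambda>l. a (Suc l)))" by simp
  then show ?case
    using Suc.prems by (simp add: u_join_Suc nonneg_path_append nonneg_path_U)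
qed

lemma sequence_pairsD:
  assumes "(s, V) \<in> sequence_pairs k a"
  shows "s \<in> extensional {0..k}" "V \<in> extensional {1..k+1}"
    and "l \<le> k \<Longrightarrow> dyck (s l)" "l \<le> k \<Longrightarrow> a l \<preceq> s l"
    and "1 \<le> i \<Longrightarrow> i \<le> k + 1 \<Longrightarrow> dyck_prefix (V i)"
    and "1 \<le> i \<Longrightarrow> i \<le> k \<Longrightarrow> U # s i @ V (i + 1) \<preceq> V i"
    and "V (k + 1) = []"
  using assms by (auto simp: sequence_pairs_def PiE_iff)

lemma bij_betw_sequence_pairs_0:
  "bij_betw (\<lambda>b. (\<lambda>l\<in>{0..0}. b, \<lambda>i\<in>{1..0+1}. [])) {b. dyck b \<and> a 0 \<preceq> b} (sequence_pairs 0 a)"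
proof (rule bij_betw_byWitness[of _ "\<lambda>(s, V). s 0"])
  show "\<forall>sV\<in>sequence_pairs 0 a. (\<lambda>l\<in>{0..0}. (case sV of (s, V) \<Rightarrow> s 0), \<lambda>i\<in>{1..0+1}. []) = sV"
  proof
    fix sV assume "sV \<in> sequence_pairs 0 a"
    moreover obtain s V where "sV = (s, V)" by (cases sV)
    ultimately show "(\<lambda>l\<in>{0..0}. (case sV of (s, V) \<Rightarrow> s 0), \<lambda>i\<in>{1..0+1}. []) = sV"
      using sequence_pairsD(1,2,7)[of s V 0 a]
      by (auto simp: fun_eq_iff extensional_def restrict_def)
  qed
  have "dyck_prefix []"
    by (simp add: dyck_prefix_iff nonneg_path_def)
  then show "(\<lambda>b. (\<lambda>l\<in>{0..0}. b, \<lambda>i\<in>{1..0+1}. [])) ` {b. dyck b \<and> a 0 \<preceq> b} \<subseteq> sequence_pairs 0 a"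
    by (auto simp: sequence_pairs_def split: if_splits)
qed (auto dest: sequence_pairsD)

text \<open>Removal of the outermost data \<open>s\<^sub>0\<close> and \<open>V\<^sub>1\<close> from a summation index, with a shift of the remaining
  sequences. The condition on \<open>V\<^sub>1\<close> refers only to the first terms of the shifted sequences.\<close>

definition split_pair :: "nat \<Rightarrow> (nat \<Rightarrow> path) \<times> (nat \<Rightarrow> path) \<Rightarrow> path \<times> ((nat \<Rightarrow> path) \<times> (nat \<Rightarrow> path)) \<times> path" where
  "split_pair k = (\<lambda>(s, V). (s 0, (\<lambda>l\<in>{0..k}. s (Suc l), \<lambda>i\<in>{1..k+1}. V (Suc i)), V 1))"

definition join_pair :: "nat \<Rightarrow> path \<times> ((nat \<Rightarrow> path) \<times> (nat \<Rightarrow> path)) \<times> path \<Rightarrow> (nat \<Rightarrow> path) \<times> (nat \<Rightarrow> path)" where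
  "join_pair k = (\<lambda>(b, (s, V), W).
     (\<lambda>l\<in>{0..Suc k}. if l = 0 then b else s (l - 1),
      \<lambda>i\<in>{1..Suc k+1}. if i = 1 then W else V (i - 1)))"

lemma bij_betw_split_pair:
  fixes a :: "nat \<Rightarrow> path"
  defines "a' \<equiv> \<lambda>l. a (Suc l)"
  shows "bij_betw (split_pair k) (sequence_pairs (Suc k) a)
    ({b. dyck b \<and> a 0 \<preceq> b} \<times> (SIGMA (s, V):sequence_pairs k a'. {W. U # s 0 @ V 1 \<preceq> W}))"
    (is "bij_betw _ _ ?S")
proof (rule bij_betw_byWitness[of _ "join_pair k"])
  show "\<forall>sV\<in>sequence_pairs (Suc k) a. join_pair k (split_pair k sV) = sV"
  proof
    fix sV assume "sV \<in> sequence_pairs (Suc k) a"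
    moreover obtain s V where "sV = (s, V)" by (cases sV)
    ultimately show "join_pair k (split_pair k sV) = sV"
      using sequence_pairsD(1,2)[of s V "Suc k" a]
      by (auto simp: join_pair_def split_pair_def fun_eq_iff extensional_def restrict_def)
  qed
  show "\<forall>x\<in>?S. split_pair k (join_pair k x) = x"
  proof
    fix x assume "x \<in> ?S"
    then obtain b s V W where "x = (b, (s, V), W)" "(s, V) \<in> sequence_pairs k a'"
      by auto
    then show "split_pair k (join_pair k x) = x"
      using sequence_pairsD(1,2)[of s V k a']
      by (auto simp: join_pair_def split_pair_def fun_eq_iff extensional_def restrict_def)
  qed
  show "split_pair k ` sequence_pairs (Suc k) a \<subseteq> ?S"
  proof (rule image_subsetI)
    fix x assume "x \<in> sequence_pairs (Suc k) a"
    then obtain s V where x: "x = (s, V)" and sV: "(s, V) \<in> sequence_pairs (Suc k) a"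
      by (cases x) auto
    note D = sequence_pairsD[OF sV]
    have "(\<lambda>l\<in>{0..k}. s (Suc l), \<lambda>i\<in>{1..k+1}. V (Suc i)) \<in> sequence_pairs k a'"
      unfolding sequence_pairs_def a'_def using D(3-7) by auto
    moreover have "U # s 1 @ V 2 \<preceq> V 1"
      using D(6)[of 1] by (simp add: numeral_2_eq_2)
    ultimately show "split_pair k x \<in> ?S"
      unfolding x using D(3,4)[of 0] by (simp add: split_pair_def numeral_2_eq_2)
  qed
  show "join_pair k ` ?S \<subseteq> sequence_pairs (Suc k) a"
  proof (rule image_subsetI)
    fix x assume "x \<in> ?S"
    then obtain b s V W where x: "x = (b, (s, V), W)" and sV: "(s, V) \<in> sequence_pairs k a'"
      and b: "dyck b" "a 0 \<preceq> b" and W: "U # s 0 @ V 1 \<preceq> W"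
      by auto
    note D = sequence_pairsD[OF sV]
    have "nonneg_path (U # s 0 @ V 1)"
      using D(3)[of 0] D(5)[of 1] by (intro nonneg_path_U nonneg_path_append) (auto simp: dyck_prefix_iff)
    then have W': "dyck_prefix W"
      using W nonneg_path_mono dyck_prefix_iff by blast
    obtain s' V' where j: "join_pair k (b, (s, V), W) = (s', V')" by (cases "join_pair k (b, (s, V), W)")
    have s'_def: "s' = (\<lambda>l\<in>{0..Suc k}. if l = 0 then b else s (l - 1))"
      and V'_def: "V' = (\<lambda>i\<in>{1..Suc k+1}. if i = 1 then W else V (i - 1))"
      using j by (auto simp: join_pair_def)
    have "dyck (s' l) \<and> a l \<preceq> s' l" if "l \<le> Suc k" for l
      using that b D(3,4)[of "l - 1"] by (cases l) (auto simp: s'_def a'_def)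
    then have "s' \<in> (\<Pi>\<^sub>E l\<in>{0..Suc k}. {b. dyck b \<and> a l \<preceq> b})"
      by (auto simp: s'_def)
    moreover have "dyck_prefix (V' i)" if "i \<in> {1..Suc k + 1}" for i
      using that W' D(5)[of "i - 1"] by (auto simp: V'_def)
    then have "V' \<in> (\<Pi>\<^sub>E i\<in>{1..Suc k + 1}. {W. dyck_prefix W})"
      by (auto simp: V'_def)
    moreover have "U # s' i @ V' (i + 1) \<preceq> V' i" if i: "i \<in> {1..Suc k}" for i
    proof (cases "i = 1")
      case True
      then show ?thesis using W by (simp add: s'_def V'_def)
    next
      case False
      then obtain i' where i': "i = Suc i'" "1 \<le> i'" "i' \<le> k" using i by (cases i) auto
      then show ?thesis using D(6)[of i'] by (auto simp: s'_def V'_def)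
    qed
    moreover have "V' (Suc k + 1) = []"
      using D(7) by (simp add: V'_def)
    ultimately show "join_pair k x \<in> sequence_pairs (Suc k) a"
      unfolding x j sequence_pairs_def by blast
  qed
qed

lemma finite_sequence_pairs: "finite (sequence_pairs k a)"
proof (induction k arbitrary: a)
  case 0
  show ?case
    using bij_betw_finite[OF bij_betw_sequence_pairs_0[of a]] finite_dyck_above by simp
next
  case (Suc k)
  have "finite ({b. dyck b \<and> a 0 \<preceq> b} \<times>
      (SIGMA (s, V):sequence_pairs k (\<lambda>l. a (Suc l)). {W. U # s 0 @ V 1 \<preceq> W}))"
    using Suc finite_dyck_above by (intro finite_cartesian_product finite_SigmaI) (auto simp: finite_above)
  then show ?case
    using bij_betw_finite[OF bij_betw_split_pair[of k a]] by simp
qed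

text \<open>The weight \<open>g\<close> must be arbitrary for the induction: removing the first factor \<open>a\<^sub>0\<close> and the upstep
  after it replaces \<open>g\<close> by the weight that sums \<open>g (b @ W)\<close> over the paths \<open>W\<close> above the
  lifted first term.\<close>

lemma sum_slow_descents_u_join:
  fixes g :: "path \<Rightarrow> nat"
  assumes "\<forall>l\<le>k. dyck (a l)"
  shows "(\<Sum>Q\<in>slow_descents (u_join k a). g (Q 0)) =
    (\<Sum>(s, V)\<in>sequence_pairs k a. (\<Prod>l = 0..k. num_v (a l) (s l)) * g (s 0 @ V 1))"
  using assms
proof (induction k arbitrary: a g)
  case 0
  then have "(\<Sum>Q\<in>slow_descents (u_join 0 a). g (Q 0)) = (\<Sum>b | dyck b \<and> a 0 \<preceq> b. num_v (a 0) b * g b)"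
    by (simp add: u_join_0 sum_slow_descents_dyck)
  also have "\<dots> = (\<Sum>(s, V)\<in>sequence_pairs 0 a. (\<Prod>l = 0..0. num_v (a l) (s l)) * g (s 0 @ V 1))"
    by (subst sum.reindex_bij_betw[OF bij_betw_sequence_pairs_0[of a], symmetric]) simp
  finally show ?case .
next
  case (Suc k)
  define a' where "a' = (\<lambda>l. a (Suc l))"
  let ?P = "u_join k a'"
  let ?Bs = "{b. dyck b \<and> a 0 \<preceq> b}"
  let ?v = "\<lambda>s. \<Prod>l = 0..k. num_v (a' l) (s l)"
  have a': "\<forall>l\<le>k. dyck (a' l)" and a0: "dyck (a 0)"
    using Suc.prems by (auto simp: a'_def)
  have "(\<Sum>Q\<in>slow_descents (u_join (Suc k) a). g (Q 0)) =
      (\<Sum>A\<in>slow_descents (a 0). \<Sum>B\<in>slow_descents (U # ?P). g (A 0 @ B 0))"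
    by (simp add: u_join_Suc a'_def[symmetric] sum_slow_descents_append[OF a0])
  also have "\<dots> = (\<Sum>b\<in>?Bs. num_v (a 0) b * (\<Sum>B\<in>slow_descents (U # ?P). g (b @ B 0)))"
    by (rule sum_slow_descents_dyck[OF a0])
  also have "\<dots> = (\<Sum>b\<in>?Bs. num_v (a 0) b *
      (\<Sum>(s, V)\<in>sequence_pairs k a'. ?v s * (\<Sum>W | U # s 0 @ V 1 \<preceq> W. g (b @ W))))"
  proof (intro sum.cong arg_cong2[where f = "(*)"] refl)
    fix b
    show "(\<Sum>B\<in>slow_descents (U # ?P). g (b @ B 0)) =
        (\<Sum>(s, V)\<in>sequence_pairs k a'. ?v s * (\<Sum>W | U # s 0 @ V 1 \<preceq> W. g (b @ W)))"
      using sum_slow_descents_U[OF nonneg_u_join[OF a'], of "\<lambda>W. g (b @ W)"]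
        Suc.IH[OF a', of "\<lambda>q. \<Sum>W | U # q \<preceq> W. g (b @ W)"] by simp
  qed
  also have "\<dots> = (\<Sum>b\<in>?Bs. \<Sum>sV\<in>sequence_pairs k a'. \<Sum>W | U # fst sV 0 @ snd sV 1 \<preceq> W.
      num_v (a 0) b * ?v (fst sV) * g (b @ W))"
    by (simp add: sum_distrib_left case_prod_unfold mult.assoc)
  also have "\<dots> = (\<Sum>(b, (s, V), W)\<in>?Bs \<times> (SIGMA (s, V):sequence_pairs k a'. {W. U # s 0 @ V 1 \<preceq> W}).
      num_v (a 0) b * ?v s * g (b @ W))"
    by (simp add: sum.cartesian_product[symmetric] sum.Sigma finite_sequence_pairs finite_above case_prod_unfold)
  also have "\<dots> = (\<Sum>(s, V)\<in>sequence_pairs (Suc k) a.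
      (\<Prod>l = 0..Suc k. num_v (a l) (s l)) * g (s 0 @ V 1))"
    unfolding a'_def
    by (subst sum.reindex_bij_betw[OF bij_betw_split_pair[of k a], symmetric])
      (simp add: split_pair_def case_prod_unfold prod.atLeast0_atMost_Suc_shift del: prod.cl_ivl_Suc)
  finally show ?case .
qed

theorem proposition3:
  fixes P :: path and k :: nat and a :: "nat \<Rightarrow> path"
  assumes "dyck_prefix P"
    and "\<forall>l\<le>k. dyck (a l)"
    and "P = u_join k a"
  shows "num_min_chains ([D, U] @ P) =
    (\<Sum>(s, V)\<in>sequence_pairs k a. (\<Prod>l = 0..k. num_v (a l) (s l)) * num_above (s 0 @ V 1))"
proof -
  have P: "nonneg_path P"
    using assms(1) by (simp add: dyck_prefix_iff)
  have "num_min_chains ([D, U] @ P) = card (slow_descents (U # P))"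
    using num_min_chains_eq_card_slow_descents[OF nonneg_path_U[OF P]] by simp
  also have "\<dots> = (\<Sum>R\<in>slow_descents P. num_above (R 0))"
    using sum_slow_descents_U[OF P, of "\<lambda>_. 1"] by (simp add: num_above_U flip: num_above_eq)
  finally show ?thesis
    using sum_slow_descents_u_join[OF assms(2), of num_above] assms(3) by simp
qed

end
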